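(* Let $\alpha\in(1,\infty)$, $\alpha':=\alpha/(\alpha-1)$, $\beta:=1/(\alpha-1)$. Let $G$ be a locally compact abelian group with dual group $\Gamma$, $\lambda$ a Haar measure on the Borel $\sigma$-algebra of $\Gamma$, $S\subseteq G$ nonempty, $w:\Gamma\to[0,\infty)$ a Borel measurable $\lambda$-integrable function, and $s\in S$. Then $$\inf\left\{\left(\int_\Gamma|\chi_s-t|^\alpha w\,d\lambda\right)^{1/\alpha}: t\in\mathcal{T}(G\setminus S)\right\}=\sup\left\{\left[\int_\Gamma|h|^{\alpha'}(w^+)^\beta d\lambda\right]^{-1/\alpha'}: h\in\mathcal{D}_s\right\},$$ with the convention that the right-hand side is $0$ if $\mathcal{D}_s$ is empty.
   Context: For $x\in G$, $\chi_x(\gamma):=\langle\gamma,x\rangle$ is the value of $\gamma\in\Gamma$ at $x$. If $G\setminus S\ne\emptyset$, $\mathcal{T}(G\setminus S)$ is the linear space of all functions $\sum_{j=1}^n u_j\chi_{x_j}$, $n\in\mathbb{N}$, $x_j\in G\setminus S$, $u_j\in\mathbb{C}$; if $G\setminus S=\emptyset$ it is $\{0\}$. Set $B:=\{\gamma\in\Gamma: w(\gamma)\neq0\}$, and $w^+:=1/w$ on $B$, $w^+:=0$ on $\Gamma\setminus B$ (so $(w^+)^\beta=0$ on $\Gamma\setminus B$). $L^{\alpha'}((w^+)^\beta)$ is the space of (classes of) Borel measurable functions $h:\Gamma\to\mathbb{C}$ with $\int_\Gamma|h|^{\alpha'}(w^+)^\beta d\lambda<\infty$, where functions are identified if they agree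 $\lambda$-a.e. on $B$ and, as a standing convention, representatives are always chosen with $h=0$ on $\Gamma\setminus B$. Such $h$ are $\lambda$-integrable. The symbol $h^*$ denotes the complex conjugate of $h$, and for integrable $f$ the inverse Fourier transform is $\check f(x):=\int_\Gamma\langle\gamma,x\rangle f(\gamma)\,\lambda(d\gamma)$, $x\in G$. Define $$\mathcal{D}:=\{h\in L^{\alpha'}((w^+)^\beta): (h^* )^{\vee}(x)=0\text{ for all }x\in G\setminus S\},\qquad \mathcal{D}_s:=\{h\in\mathcal{D}: (h^* )^{\vee}(s)=1\},$$ where $(h^* )^\vee$ is the inverse Fourier transform of $h^*$. *)

theory Defs
  imports "HOL-Analysis.Analysis"
begin

definition is_character :: "('a::topological_ab_group_add \<Rightarrow> complex) \<Rightarrow> bool" where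
  "is_character f \<longleftrightarrow>
     continuous_on UNIV f \<and> (\<forall>x. norm (f x) = 1) \<and> (\<forall>x y. f (x + y) = f x * f y)"

typedef (overloaded) 'a dual_group = "{f :: 'a::topological_ab_group_add \<Rightarrow> complex. is_character f}"
  morphisms pairing Abs_dual_group
  by (rule exI[of _ "\<lambda>_. 1"]) (simp add: is_character_def)

setup_lifting type_definition_dual_group

text \<open>The group operation of the dual group is pointwise multiplication of characters; it is
  written additively because the library's type class of abelian groups is additive.\<close>

instantiation dual_group :: (topological_ab_group_add) ab_group_add
begin

lift_definition zero_dual_group :: "'a dual_group" is "\<lambda>_. 1"
  by (simp add: is_character_def)

lift_definition plus_dual_group :: "'a dual_group \<Rightarrow> 'a dual_group \<Rightarrow> 'a dual_group"
  is "\<lambda>f g x. f x * g x"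
  by (auto simp: is_character_def norm_mult intro!: continuous_intros)

lift_definition uminus_dual_group :: "'a dual_group \<Rightarrow> 'a dual_group"
  is "\<lambda>f x. inverse (f x)"
  by (auto simp: is_character_def norm_inverse intro!: continuous_intros)
     (metis norm_zero zero_neq_one)

definition minus_dual_group :: "'a dual_group \<Rightarrow> 'a dual_group \<Rightarrow> 'a dual_group" where
  "minus_dual_group f g = f + - g"

instance
proof
  fix a b c :: "'a dual_group"
  show "a + b + c = a + (b + c)" by transfer (simp add: mult.assoc)
  show "a + b = b + a" by transfer (simp add: mult.commute)
  show "0 + a = a" by transfer simp
  show "- a + a = 0"
    by transfer (auto simp: is_character_def fun_eq_iff, metis norm_zero zero_neq_one left_inverse)
  show "a - b = a + - b" by (simp add: minus_dual_group_def)
qed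

end

text \<open>The topology of the dual group is the compact-open topology.\<close>

instantiation dual_group :: (topological_ab_group_add) topological_space
begin

definition open_dual_group :: "'a dual_group set \<Rightarrow> bool" where
  "open_dual_group =
     generate_topology {{\<gamma>. pairing \<gamma> ` K \<subseteq> U} | K U. compact K \<and> open U}"

instance
  by standard
     (auto simp: open_dual_group_def intro: generate_topology.intros)

end

text \<open>Haar measures are the nonzero translation-invariant Radon measures. As the group need not
  be \<open>\<sigma>\<close>-compact, inner regularity is demanded for open sets only. The
  conjuncts \<open>K \<in> sets borel\<close> are automatic in Hausdorff groups, in particular in dual groups.\<close>

definition haar_measure :: "'b::{ab_group_add, topological_space} measure \<Rightarrow> bool" where
  "haar_measure \<mu> \<longleftrightarrow>
     sets \<mu> = sets borel \<and>
     emeasure \<mu> UNIV \<noteq> 0 \<and>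
     (\<forall>g. \<forall>A\<in>sets borel. emeasure \<mu> ((+) g ` A) = emeasure \<mu> A) \<and>
     (\<forall>K. compact K \<longrightarrow> K \<in> sets borel \<longrightarrow> emeasure \<mu> K < \<infinity>) \<and>
     (\<forall>A\<in>sets borel. emeasure \<mu> A = (INF U\<in>{U. open U \<and> A \<subseteq> U}. emeasure \<mu> U)) \<and>
     (\<forall>U. open U \<longrightarrow>
        emeasure \<mu> U = (SUP K\<in>{K. compact K \<and> K \<in> sets borel \<and> K \<subseteq> U}. emeasure \<mu> K))"

definition chi :: "'a::topological_ab_group_add \<Rightarrow> 'a dual_group \<Rightarrow> complex" where
  "chi x \<gamma> = pairing \<gamma> x"

text \<open>The empty sum \<open>n = 0\<close> is admitted, so that \<open>trig_polys {} = {\<lambda>_. 0}\<close>; for nonempty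
  \<open>X\<close> it adds nothing.\<close>

definition trig_polys :: "'a::topological_ab_group_add set \<Rightarrow> ('a dual_group \<Rightarrow> complex) set" where
  "trig_polys X =
     {\<lambda>\<gamma>. \<Sum>j<n. u j * chi (x j) \<gamma> | (n::nat) (u :: nat \<Rightarrow> complex) x. \<forall>j<n. x j \<in> X}"

definition inv_fourier ::
    "'a::topological_ab_group_add dual_group measure \<Rightarrow> ('a dual_group \<Rightarrow> complex) \<Rightarrow> 'a \<Rightarrow> complex" where
  "inv_fourier \<mu> f x = (\<integral>\<gamma>. pairing \<gamma> x * f \<gamma> \<partial>\<mu>)"

definition w_plus :: "('b \<Rightarrow> real) \<Rightarrow> 'b \<Rightarrow> real" where
  "w_plus w \<gamma> = (if w \<gamma> \<noteq> 0 then 1 / w \<gamma> else 0)"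

text \<open>The elements are functions rather than classes, normalised to vanish where \<open>w\<close> does.\<close>

definition L_w_plus :: "'b::topological_space measure \<Rightarrow> ('b \<Rightarrow> real) \<Rightarrow> real \<Rightarrow> real \<Rightarrow> ('b \<Rightarrow> complex) set" where
  "L_w_plus \<mu> w p b =
     {h \<in> borel_measurable borel.
        (\<integral>\<^sup>+\<gamma>. ennreal (norm (h \<gamma>) powr p * w_plus w \<gamma> powr b) \<partial>\<mu>) < \<infinity> \<and>
        (\<forall>\<gamma>. w \<gamma> = 0 \<longrightarrow> h \<gamma> = 0)}"

definition D_space ::
    "'a::topological_ab_group_add dual_group measure \<Rightarrow> ('a dual_group \<Rightarrow> real) \<Rightarrow> real \<Rightarrow> real \<Rightarrow> 'a set
     \<Rightarrow> ('a dual_group \<Rightarrow> complex) set" where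
  "D_space \<mu> w p b S =
     {h \<in> L_w_plus \<mu> w p b. \<forall>x\<in>- S. inv_fourier \<mu> (\<lambda>\<gamma>. cnj (h \<gamma>)) x = 0}"

definition D_at ::
    "'a::topological_ab_group_add dual_group measure \<Rightarrow> ('a dual_group \<Rightarrow> real) \<Rightarrow> real \<Rightarrow> real \<Rightarrow> 'a set \<Rightarrow> 'a
     \<Rightarrow> ('a dual_group \<Rightarrow> complex) set" where
  "D_at \<mu> w p b S s =
     {h \<in> D_space \<mu> w p b S. inv_fourier \<mu> (\<lambda>\<gamma>. cnj (h \<gamma>)) s = 1}"

end

theory Submission
  imports Defs
begin

text \<open>
  The identity is the duality formula for the distance from a vector to a subspace, read in
  the space \<open>L\<^sup>\<alpha>\<close> of the measure \<open>\<nu> = w \<lambda>\<close>, which is finite because \<open>w\<close> is integrable. The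
  map \<open>g \<mapsto> w g\<^sup>*\<close> carries \<open>L\<^bsup>\<alpha>'\<^esup>(\<nu>)\<close> isometrically onto \<open>L\<^bsup>\<alpha>'\<^esup>((w\<^sup>+)\<^sup>\<beta>)\<close>, because \<open>\<alpha>' - \<beta> = 1\<close>,
  and it turns the pairing \<open>\<integral> \<chi>\<^sub>x g d\<nu>\<close> into the inverse Fourier transform of \<open>h\<^sup>*\<close> at \<open>x\<close>.
  Hence \<open>\<D>\<close> is the annihilator of the trigonometric polynomials with frequencies outside \<open>S\<close>,
  and \<open>\<D>\<^sub>s\<close> consists of those elements of it that take the value 1 at \<open>\<chi>\<^sub>s\<close>.

  That the supremum is at most the infimum is Hoelder's inequality applied to
  \<open>1 = \<integral> (\<chi>\<^sub>s - t) g d\<nu>\<close>, lemma \<open>distance_duality_le\<close>. It also shows that \<open>\<D>\<^sub>s\<close> is empty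
  when the distance is 0.

  For the converse an extremal \<open>g\<close> is constructed from a best approximation rather than from
  the Hahn-Banach theorem and a representation of the dual space. By strict convexity of
  \<open>\<bar>z\<bar>\<^sup>\<alpha>\<close>, homogeneity and compactness, \<open>\<bar>a - b\<bar>\<^sup>\<alpha>\<close> is controlled by how far the midpoint
  falls below the mean (\<open>norm_powr_uniform_convexity\<close>), so a minimizing sequence
  \<open>\<chi>\<^sub>s - t\<^sub>n\<close> is Cauchy and has a limit \<open>u\<close> in \<open>L\<^sup>\<alpha>(\<nu>)\<close>
  (\<open>Lp_complete\<close>, \<open>Lp_minimizing_sequence_converges\<close>). The
  first-order condition at the minimum says that \<open>g = \<bar>u\<bar>\<^bsup>\<alpha>-2\<^esup> u\<^sup>*\<close> annihilates the subspace
  (\<open>duality_map_orthogonal\<close>). Then \<open>\<integral> \<chi>\<^sub>s g d\<nu> = \<integral> u g d\<nu> = \<integral> \<bar>u\<bar>\<^sup>\<alpha> d\<nu>\<close> is the \<open>\<alpha>\<close>-th power of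
  the distance, and if this is positive a multiple of \<open>g\<close> attains the supremum
  (\<open>distance_duality_attained\<close>).
\<close>

section \<open>Strict and uniform convexity of the power of the modulus\<close>

text \<open>The derivative of \<open>x powr p\<close> is strictly increasing; the mean value theorem, rather than
  a second derivative, includes the endpoint 0, where for \<open>p < 2\<close> there is no second derivative.\<close>

lemma powr_tangent_less:
  fixes x y p :: real
  assumes p: "1 < p" and x: "0 \<le> x" and y: "0 \<le> y" and ne: "x \<noteq> y"
  shows "p * x powr (p - 1) * (y - x) < y powr p - x powr p"
proof -
  have mvt: "\<exists>z. a < z \<and> z < b \<and> b powr p - a powr p = (b - a) * (p * z powr (p - 1))"
    if "0 \<le> a" "a < b" for a b :: real
  proof -
    have "continuous_on {a..b} (\<lambda>z. z powr p)"
      using p that by (intro continuous_on_powr' continuous_intros) auto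
    moreover have "((\<lambda>z. z powr p) has_derivative (\<lambda>h. h * (p * z powr (p - 1)))) (at z)"
      if "a < z" "z < b" for z
      using has_real_derivative_powr[of z p] that \<open>0 \<le> a\<close>
      by (simp add: has_field_derivative_def mult.commute[of "p * z powr (p - 1)"] mult_commute_abs)
    ultimately show ?thesis
      using mvt[OF \<open>a < b\<close>, of "\<lambda>z. z powr p" "\<lambda>z h. h * (p * z powr (p - 1))"] by auto
  qed
  show ?thesis
  proof (cases "x < y")
    case True
    then obtain z where z: "x < z" "z < y" "y powr p - x powr p = (y - x) * (p * z powr (p - 1))"
      using mvt x by blast
    have "x powr (p - 1) < z powr (p - 1)" using z x p by (intro powr_less_mono2) auto
    then show ?thesis using z p True by (simp add: mult.commute)
  next
    case False
    then have yx: "y < x" using ne by simp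
    then obtain z where z: "y < z" "z < x" "x powr p - y powr p = (x - y) * (p * z powr (p - 1))"
      using mvt y by blast
    have "z powr (p - 1) < x powr (p - 1)" using z y p by (intro powr_less_mono2) auto
    then have "(x - y) * (p * z powr (p - 1)) < (x - y) * (p * x powr (p - 1))"
      using p yx by simp
    then show ?thesis using z(3) by (simp add: algebra_simps)
  qed
qed

text \<open>Up to the factor \<open>p\<close>, the gradient of \<open>\<bar>z\<bar>\<^sup>p\<close>, conjugated so that the derivative in the
  direction \<open>v\<close> is \<open>p Re (duality_map p z * v)\<close>. Composition with it maps \<open>L\<^sup>p\<close> to \<open>L\<^sup>q\<close>.\<close>

definition duality_map :: "real \<Rightarrow> complex \<Rightarrow> complex" where
  "duality_map p z = of_real (norm z powr (p - 2)) * cnj z"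

lemma powr_diff2_times: "x powr (p - 2) * x = x powr (p - 1)" if "0 \<le> (x::real)"
  using powr_add[of x "p - 2" 1] that by (cases "x = 0") auto

lemma norm_duality_map: "norm (duality_map p z) = norm z powr (p - 1)"
  by (simp add: duality_map_def norm_mult powr_diff2_times)

lemma powr_diff1_times: "x powr (p - 1) * x = x powr p" if "0 \<le> (x::real)"
  using powr_add[of x "p - 1" 1] that by (cases "x = 0") auto

lemma duality_map_times_self: "duality_map p z * z = of_real (norm z powr p)"
proof -
  have "duality_map p z * z = of_real (norm z powr (p - 2)) * (z * cnj z)"
    by (simp add: duality_map_def algebra_simps)
  also have "\<dots> = of_real (norm z powr (p - 2) * norm z * norm z)"
    unfolding complex_norm_square[symmetric] by (simp add: power2_eq_square)
  finally show ?thesis by (simp add: powr_diff2_times powr_diff1_times)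
qed

lemma isCont_duality_map:
  assumes "1 < p" shows "isCont (duality_map p) z"
proof (cases "z = 0")
  case True
  have "((\<lambda>x::complex. norm x) \<longlongrightarrow> 0) (at 0)" by (rule tendsto_norm_zero) simp
  then have "((\<lambda>x::complex. norm x powr (p - 1)) \<longlongrightarrow> 0 powr (p - 1)) (at 0)"
    using assms by (intro tendsto_powr') auto
  then have "((\<lambda>x. norm (duality_map p x)) \<longlongrightarrow> 0) (at 0)"
    using assms by (simp add: norm_duality_map)
  then have "(duality_map p \<longlongrightarrow> 0) (at 0)" by (rule tendsto_norm_zero_cancel)
  then show ?thesis using True by (simp add: isCont_def duality_map_def)
next
  case False
  then show ?thesis unfolding duality_map_def by (intro continuous_intros) auto
qed

lemma duality_map_measurable [measurable]:
  assumes "1 < p" shows "duality_map p \<in> borel_measurable borel"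
  using assms by (intro borel_measurable_continuous_onI continuous_at_imp_continuous_on)
    (auto intro: isCont_duality_map)

lemma Re_duality_map_le: "Re (duality_map p a * b) \<le> norm a powr (p - 1) * norm b"
  by (metis complex_Re_le_cmod norm_mult norm_duality_map)

text \<open>Strict inequality comes from one of two sources: if the moduli differ, from strict
  convexity of the real power function; if they agree, from the equality case of the
  Cauchy-Schwarz inequality in the plane.\<close>

lemma norm_powr_tangent_less:
  fixes a b :: complex
  assumes p: "1 < p" and ne: "a \<noteq> b"
  shows "norm a powr p + p * Re (duality_map p a * (b - a)) < norm b powr p"
proof -
  define R where "R = Re (duality_map p a * b)"
  have eq: "Re (duality_map p a * (b - a)) = R - norm a powr p"
    unfolding right_diff_distrib duality_map_times_self R_def by simp
  have R: "R \<le> norm a powr (p - 1) * norm b" unfolding R_def by (rule Re_duality_map_le)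
  show ?thesis
  proof (cases "norm a = norm b")
    case False
    have "p * (R - norm a powr p) \<le> p * norm a powr (p - 1) * (norm b - norm a)"
      using mult_left_mono[OF R, of p] p powr_diff1_times[of "norm a" p]
      by (simp add: algebra_simps)
    then show ?thesis
      using powr_tangent_less[OF p, of "norm a" "norm b"] False unfolding eq by simp
  next
    case True
    with ne have a0: "a \<noteq> 0" by auto
    have "Re (cnj a * b) \<noteq> norm a * norm b"
    proof
      assume "Re (cnj a * b) = norm a * norm b"
      then have "inner a b = norm a * norm b" by (simp add: inner_complex_def)
      then have "norm a *\<^sub>R b = norm b *\<^sub>R a" using norm_cauchy_schwarz_eq by metis
      with True a0 ne show False by simp
    qed
    moreover have "Re (cnj a * b) \<le> norm a * norm b"
      by (metis complex_Re_le_cmod norm_mult complex_mod_cnj)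
    ultimately have "norm a powr (p - 2) * Re (cnj a * b) < norm a powr (p - 2) * (norm a * norm b)"
      using a0 by simp
    moreover have "R = norm a powr (p - 2) * Re (cnj a * b)"
      by (simp add: R_def duality_map_def mult.assoc)
    moreover have "norm a powr (p - 2) * (norm a * norm b) = norm a powr p"
      using True by (simp add: powr_diff2_times powr_diff1_times flip: mult.assoc)
    ultimately have "p * (R - norm a powr p) < 0" using p by (simp add: mult_pos_neg)
    then show ?thesis using True unfolding eq by simp
  qed
qed

lemma norm_powr_tangent_le:
  fixes a b :: complex
  assumes "1 < p"
  shows "norm a powr p + p * Re (duality_map p a * (b - a)) \<le> norm b powr p"
  using norm_powr_tangent_less[OF assms, of a b] by (cases "a = b") auto

text \<open>The first-order terms of the tangents at the midpoint towards \<open>a\<close> and \<open>b\<close> cancel.\<close>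

lemma norm_powr_midpoint_less:
  fixes a b :: complex
  assumes p: "1 < p" and ne: "a \<noteq> b"
  shows "norm ((a + b) / 2) powr p < (norm a powr p + norm b powr p) / 2"
proof -
  define m where "m = (a + b) / 2"
  define X where "X = Re (duality_map p m * (a - m))"
  have "m \<noteq> a" and "b - m = - (a - m)" using ne by (auto simp: m_def field_simps)
  then have "Re (duality_map p m * (b - m)) = - X"
    unfolding X_def by (metis mult_minus_right uminus_complex.sel(1))
  then have "norm m powr p + p * (- X) \<le> norm b powr p"
    using norm_powr_tangent_le[OF p, of m b] by metis
  moreover have "norm m powr p + p * X < norm a powr p"
    unfolding X_def by (rule norm_powr_tangent_less[OF p \<open>m \<noteq> a\<close>])
  ultimately show ?thesis by (simp add: m_def[symmetric])
qed

lemma norm_powr_add_le: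
  fixes a b :: "'a::real_normed_vector"
  assumes "0 < p"
  shows "norm (a + b) powr p \<le> 2 powr p * (norm a powr p + norm b powr p)"
proof -
  have "norm (a + b) powr p \<le> (2 * max (norm a) (norm b)) powr p"
    using assms norm_triangle_ineq[of a b] by (intro powr_mono2) auto
  also have "\<dots> = 2 powr p * max (norm a) (norm b) powr p" by (simp add: powr_mult)
  also have "max (norm a) (norm b) powr p \<le> norm a powr p + norm b powr p"
    by (simp add: max_def)
  finally show ?thesis by simp
qed

text \<open>Both sides are homogeneous of degree \<open>p\<close>, so only pairs with \<open>max \<bar>a\<bar> \<bar>b\<bar> = 1\<close> matter. If
  \<open>a\<close> and \<open>b\<close> are close, the first term on the right is enough; the remaining pairs form a
  compact set, on which the midpoint gap has a positive minimum. Being pointwise, the estimate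
  can be integrated, and it replaces Clarkson's inequalities for all exponents at once.\<close>

lemma norm_powr_uniform_convexity:
  fixes p e :: real
  assumes p: "1 < p" and e: "0 < e"
  obtains C where "0 < C" "\<And>a b :: complex. norm (a - b) powr p
      \<le> e * (norm a powr p + norm b powr p)
        + C * ((norm a powr p + norm b powr p) / 2 - norm ((a + b) / 2) powr p)"
proof -
  \<comment> \<open>\<open>\<delta>\<^sup>p = e\<close>, so that \<open>\<bar>a - b\<bar> < \<delta> max \<bar>a\<bar> \<bar>b\<bar>\<close> yields the bound by the first term.\<close>
  define \<delta> where "\<delta> = e powr (1 / p)"
  have \<delta>: "0 < \<delta>" "\<delta> powr p = e" using e p by (auto simp: \<delta>_def powr_powr)
  define gap where "gap = (\<lambda>z::complex \<times> complex.
    (norm (fst z) powr p + norm (snd z) powr p) / 2 - norm ((fst z + snd z) / 2) powr p)"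
  define K where "K = {z::complex \<times> complex. max (norm (fst z)) (norm (snd z)) = 1} \<inter>
                       {z. \<delta> \<le> norm (fst z - snd z)}"
  have cont: "continuous_on K gap"
    unfolding gap_def using p by (intro continuous_intros continuous_on_powr') auto
  have "compact K" unfolding compact_eq_bounded_closed
  proof
    have "norm z \<le> 2" if "z \<in> K" for z
      using that norm_Pair_le[of "fst z" "snd z"] by (auto simp: K_def max_def split: if_splits)
    then show "bounded K" unfolding bounded_iff by blast
    show "closed K" unfolding K_def
      by (intro closed_Int closed_Collect_eq closed_Collect_le continuous_intros)
  qed
  have gap_pos: "0 < gap z" if "z \<in> K" for z
  proof -
    have "fst z \<noteq> snd z" using that \<delta> by (auto simp: K_def)
    then show ?thesis
      using norm_powr_midpoint_less[OF p, of "fst z" "snd z"] by (simp add: gap_def)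
  qed
  obtain m where m: "0 < m" "\<And>z. z \<in> K \<Longrightarrow> m \<le> gap z"
  proof (cases "K = {}")
    case False
    then obtain z where "z \<in> K" "\<forall>y\<in>K. gap z \<le> gap y"
      using continuous_attains_inf[OF \<open>compact K\<close> False cont] by blast
    then show ?thesis using that gap_pos by blast
  qed (use that[of 1] in auto)
  have gap_nn: "0 \<le> gap z" for z
    using norm_powr_midpoint_less[OF p, of "fst z" "snd z"]
    by (cases "fst z = snd z") (auto simp: gap_def)
  show ?thesis
  proof (rule that[of "2 powr p / m"])
    show "0 < 2 powr p / m" using m by simp
    fix a b :: complex
    define r where "r = max (norm a) (norm b)"
    have rp: "r powr p \<le> norm a powr p + norm b powr p" by (simp add: r_def max_def)
    have "norm (a - b) powr p \<le> e * (norm a powr p + norm b powr p) + 2 powr p / m * gap (a, b)"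
    proof (cases "norm (a - b) < \<delta> * r")
      case True
      then have "norm (a - b) powr p \<le> (\<delta> * r) powr p" using p by (intro powr_mono2) auto
      also have "\<dots> = e * r powr p" using \<delta> by (simp add: powr_mult r_def)
      also have "\<dots> \<le> e * (norm a powr p + norm b powr p)" using rp e by simp
      finally show ?thesis using gap_nn[of "(a, b)"] m by (simp add: add_increasing2)
    next
      case False
      show ?thesis
      proof (cases "r = 0")
        case True
        then have "a = 0" "b = 0" by (auto simp: r_def max_def split: if_splits)
        then show ?thesis by (simp add: gap_def)
      next
        case r0: False
        then have r: "0 < r" by (auto simp: r_def max_def split: if_splits)
        define a' b' where "a' = a / of_real r" and "b' = b / of_real r"
        have ab: "a = of_real r * a'" "b = of_real r * b'" using r by (auto simp: a'_def b'_def)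
        have na: "norm a = r * norm a'" "norm b = r * norm b'" "norm (a - b) = r * norm (a' - b')"
          "norm ((a + b) / 2) = r * norm ((a' + b') / 2)"
          unfolding ab using r
          by (simp_all add: norm_mult norm_divide flip: right_diff_distrib distrib_left)
        have "max (norm a') (norm b') = 1"
          using r by (auto simp: a'_def b'_def norm_divide r_def max_def)
        moreover have "\<delta> \<le> norm (a' - b')" using False r unfolding na by (simp add: mult.commute)
        ultimately have mg: "m \<le> gap (a', b')" by (intro m) (auto simp: K_def)
        have gaps: "gap (a, b) = r powr p * gap (a', b')"
          unfolding gap_def fst_conv snd_conv na powr_mult by (simp add: algebra_simps)
        have "norm (a - b) powr p \<le> (2 * r) powr p"
          using p norm_triangle_ineq4[of a b] by (intro powr_mono2) (auto simp: r_def)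
        also have "\<dots> = 2 powr p * r powr p" using r by (simp add: powr_mult)
        also have "\<dots> \<le> 2 powr p / m * gap (a, b)"
          unfolding gaps using m mult_left_mono[OF mg, of "2 powr p * r powr p"]
          by (simp add: field_simps)
        finally show ?thesis using e by (simp add: add_increasing)
      qed
    qed
    then show "norm (a - b) powr p \<le> e * (norm a powr p + norm b powr p)
        + 2 powr p / m * ((norm a powr p + norm b powr p) / 2 - norm ((a + b) / 2) powr p)"
      by (simp add: gap_def)
  qed
qed

section \<open>Hoelder duality of the Lp functions\<close>

text \<open>Functions rather than classes modulo null sets: best approximation is carried out with
  explicit representatives and integrals, without a normed quotient space.\<close>

definition Lp_functions :: "'a measure \<Rightarrow> real \<Rightarrow> ('a \<Rightarrow> complex) set" where
  "Lp_functions M p = {f \<in> borel_measurable M. integrable M (\<lambda>x. norm (f x) powr p)}"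

lemma Lp_functions_measurable [measurable_dest]:
  "f \<in> Lp_functions M p \<Longrightarrow> f \<in> borel_measurable M"
  by (simp add: Lp_functions_def)

lemma Lp_functions_integrable: "f \<in> Lp_functions M p \<Longrightarrow> integrable M (\<lambda>x. norm (f x) powr p)"
  by (simp add: Lp_functions_def)

lemma Lp_functions_add:
  assumes p: "0 < p" and f: "f \<in> Lp_functions M p" and g: "g \<in> Lp_functions M p"
  shows "(\<lambda>x. f x + g x) \<in> Lp_functions M p"
proof -
  note [measurable] = Lp_functions_measurable[OF f] Lp_functions_measurable[OF g]
  have "integrable M (\<lambda>x. norm (f x + g x) powr p)"
    by (rule Bochner_Integration.integrable_bound[of M
          "\<lambda>x. 2 powr p * (norm (f x) powr p + norm (g x) powr p)"])
       (use f g p norm_powr_add_le in \<open>auto intro!: Lp_functions_integrable\<close>)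
  then show ?thesis by (simp add: Lp_functions_def)
qed

lemma Lp_functions_scale:
  assumes f: "f \<in> Lp_functions M p"
  shows "(\<lambda>x. c * f x) \<in> Lp_functions M p"
  using Lp_functions_integrable[OF f] Lp_functions_measurable[OF f]
  by (simp add: Lp_functions_def norm_mult powr_mult)

lemma Lp_functions_diff:
  assumes p: "0 < p" and f: "f \<in> Lp_functions M p" and g: "g \<in> Lp_functions M p"
  shows "(\<lambda>x. f x - g x) \<in> Lp_functions M p"
  using Lp_functions_add[OF p f Lp_functions_scale[OF g, of "-1"]] by simp

lemma conjugate_exponent:
  fixes p q :: real
  assumes "1 < p" and "q = p / (p - 1)"
  shows "1 < q" "1 / p + 1 / q = 1" "(p - 1) * q = p"
proof -
  have "q = 1 + 1 / (p - 1)" using assms by (simp add: divide_simps)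
  then show "1 < q" using assms by simp
  show "(p - 1) * q = p" using assms by simp
  have "1 / q = (p - 1) / p" using assms by simp
  then show "1 / p + 1 / q = 1" using assms by (simp add: diff_divide_distrib)
qed

lemma Holder_integrable:
  assumes p: "1 < p" and q: "q = p / (p - 1)"
    and f: "f \<in> Lp_functions M p" and g: "g \<in> Lp_functions M q"
  shows "integrable M (\<lambda>x. f x * g x)"
proof -
  note [measurable] = Lp_functions_measurable[OF f] Lp_functions_measurable[OF g]
  note e = conjugate_exponent[OF p q]
  show ?thesis
    by (rule Bochner_Integration.integrable_bound[of M
          "\<lambda>x. norm (f x) powr p / p + norm (g x) powr q / q"])
       (use Youngs_inequality[OF p e(1) e(2)] f g p e(1) in
         \<open>auto intro!: Lp_functions_integrable integrable_divide simp: norm_mult\<close>)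
qed

text \<open>Young's inequality for the functions divided by their norms, integrated. A factor of norm 0
  vanishes almost everywhere.\<close>

lemma Holder_inequality:
  assumes p: "1 < p" and q: "q = p / (p - 1)"
    and f: "f \<in> Lp_functions M p" and g: "g \<in> Lp_functions M q"
  shows "norm (\<integral>x. f x * g x \<partial>M)
      \<le> (\<integral>x. norm (f x) powr p \<partial>M) powr (1 / p) * (\<integral>x. norm (g x) powr q \<partial>M) powr (1 / q)"
proof -
  note [measurable] = Lp_functions_measurable[OF f] Lp_functions_measurable[OF g]
  note e = conjugate_exponent[OF p q]
  define A where "A = (\<integral>x. norm (f x) powr p \<partial>M)"
  define B where "B = (\<integral>x. norm (g x) powr q \<partial>M)"
  have A0: "0 \<le> A" and B0: "0 \<le> B" unfolding A_def B_def by (auto intro!: integral_nonneg_AE)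
  have null: "(\<integral>x. f x * g x \<partial>M) = 0" if "A = 0 \<or> B = 0"
  proof (rule integral_eq_zero_AE)
    from that show "AE x in M. f x * g x = 0"
    proof
      assume "A = 0"
      then have "AE x in M. norm (f x) powr p = 0"
        using integral_nonneg_eq_0_iff_AE[OF Lp_functions_integrable[OF f]] by (simp add: A_def)
      then show ?thesis by eventually_elim simp
    next
      assume "B = 0"
      then have "AE x in M. norm (g x) powr q = 0"
        using integral_nonneg_eq_0_iff_AE[OF Lp_functions_integrable[OF g]] by (simp add: B_def)
      then show ?thesis by eventually_elim simp
    qed
  qed
  have "norm (\<integral>x. f x * g x \<partial>M) \<le> A powr (1 / p) * B powr (1 / q)"
  proof (cases "A = 0 \<or> B = 0")
    case False
    with A0 B0 have A: "0 < A" and B: "0 < B" by auto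
    define c where "c = A powr (1 / p) * B powr (1 / q)"
    have c: "0 < c" using A B by (simp add: c_def)
    have bound: "norm (f x * g x) \<le> c * (norm (f x) powr p / (p * A) + norm (g x) powr q / (q * B))" for x
    proof -
      have "(norm (f x) / A powr (1 / p)) * (norm (g x) / B powr (1 / q))
          \<le> (norm (f x) / A powr (1 / p)) powr p / p + (norm (g x) / B powr (1 / q)) powr q / q"
        by (rule Youngs_inequality) (use p e in auto)
      also have "\<dots> = norm (f x) powr p / (p * A) + norm (g x) powr q / (q * B)"
        using p e(1) A B by (simp add: powr_divide powr_powr mult.commute)
      also have "(norm (f x) / A powr (1 / p)) * (norm (g x) / B powr (1 / q)) = norm (f x * g x) / c"
        by (simp add: c_def norm_mult)
      finally show ?thesis using c by (simp add: divide_le_eq mult.commute)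
    qed
    have "norm (\<integral>x. f x * g x \<partial>M)
        \<le> (\<integral>x. c * (norm (f x) powr p / (p * A) + norm (g x) powr q / (q * B)) \<partial>M)"
      by (rule order_trans[OF integral_norm_bound integral_mono])
         (use bound Holder_integrable[OF p q f g] f g in
           \<open>auto intro!: Lp_functions_integrable integrable_divide\<close>)
    also have "\<dots> = c * (A / (p * A) + B / (q * B))"
      using Lp_functions_integrable[OF f] Lp_functions_integrable[OF g] by (simp add: A_def B_def)
    also have "\<dots> = c" using A B e(2) by simp
    finally show ?thesis by (simp add: c_def)
  qed (use null in auto)
  then show ?thesis by (simp add: A_def B_def)
qed

lemma duality_map_Lp:
  assumes p: "1 < p" and q: "q = p / (p - 1)" and f: "f \<in> Lp_functions M p"
  shows "(\<lambda>x. duality_map p (f x)) \<in> Lp_functions M q"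
    and "norm (duality_map p (f x)) powr q = norm (f x) powr p"
proof -
  show *: "norm (duality_map p (f x)) powr q = norm (f x) powr p" for x
    using conjugate_exponent(3)[OF p q] by (simp add: norm_duality_map powr_powr)
  note [measurable] = Lp_functions_measurable[OF f] duality_map_measurable[OF p]
  show "(\<lambda>x. duality_map p (f x)) \<in> Lp_functions M q"
    using Lp_functions_integrable[OF f] by (simp add: Lp_functions_def *)
qed

text \<open>Integrate the tangent inequality at \<open>f\<close> and estimate the linear term by Hoelder. This
  one-sided Lipschitz bound does the work of the triangle inequality for the norm.\<close>

lemma Lp_power_diff_le:
  assumes p: "1 < p" and q: "q = p / (p - 1)"
    and f: "f \<in> Lp_functions M p" and g: "g \<in> Lp_functions M p"
  shows "(\<integral>x. norm (f x) powr p \<partial>M) - (\<integral>x. norm (g x) powr p \<partial>M)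
    \<le> p * (\<integral>x. norm (f x) powr p \<partial>M) powr (1 / q) * (\<integral>x. norm (g x - f x) powr p \<partial>M) powr (1 / p)"
proof -
  have gf: "(\<lambda>x. g x - f x) \<in> Lp_functions M p" using p f g by (intro Lp_functions_diff) auto
  note Jf = duality_map_Lp[OF p q f]
  let ?I = "\<integral>x. (g x - f x) * duality_map p (f x) \<partial>M"
  have int: "integrable M (\<lambda>x. (g x - f x) * duality_map p (f x))"
    by (rule Holder_integrable[OF p q gf Jf(1)])
  have "(\<integral>x. norm (f x) powr p + p * Re ((g x - f x) * duality_map p (f x)) \<partial>M)
      \<le> (\<integral>x. norm (g x) powr p \<partial>M)"
  proof (rule integral_mono)
    show "norm (f x) powr p + p * Re ((g x - f x) * duality_map p (f x)) \<le> norm (g x) powr p" for x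
      unfolding mult.commute[of "g x - f x"] by (rule norm_powr_tangent_le[OF p])
    show "integrable M (\<lambda>x. norm (f x) powr p + p * Re ((g x - f x) * duality_map p (f x)))"
      using Lp_functions_integrable[OF f] int
      by (intro Bochner_Integration.integrable_add integrable_mult_right integrable_Re)
  qed (rule Lp_functions_integrable[OF g])
  also have "(\<integral>x. norm (f x) powr p + p * Re ((g x - f x) * duality_map p (f x)) \<partial>M)
      = (\<integral>x. norm (f x) powr p \<partial>M) + p * Re ?I"
    using Lp_functions_integrable[OF f] int by (simp del: times_complex.sel)
  finally have "(\<integral>x. norm (f x) powr p \<partial>M) - (\<integral>x. norm (g x) powr p \<partial>M) \<le> p * (- Re ?I)" by simp
  also have "\<dots> \<le> p * norm ?I" using p abs_Re_le_cmod[of ?I] by (intro mult_left_mono) linarith+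
  also have "\<dots> \<le> p * ((\<integral>x. norm (g x - f x) powr p \<partial>M) powr (1 / p) *
      (\<integral>x. norm (f x) powr p \<partial>M) powr (1 / q))"
    using Holder_inequality[OF p q gf Jf(1)] p by (intro mult_left_mono) (auto simp: Jf(2))
  finally show ?thesis by (simp add: ac_simps)
qed

text \<open>Apply \<open>Lp_power_diff_le\<close> in both directions; its right-hand side tends to 0 because the
  integrals of \<open>\<bar>g n\<bar>\<^sup>p\<close> stay bounded.\<close>

lemma Lp_power_tendsto:
  assumes p: "1 < p" and f: "f \<in> Lp_functions M p" and g: "\<And>n::nat. g n \<in> Lp_functions M p"
    and lim: "(\<lambda>n. \<integral>x. norm (g n x - f x) powr p \<partial>M) \<longlonglongrightarrow> 0"
  shows "(\<lambda>n. \<integral>x. norm (g n x) powr p \<partial>M) \<longlonglongrightarrow> (\<integral>x. norm (f x) powr p \<partial>M)"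
proof -
  define q where "q = p / (p - 1)"
  note e = conjugate_exponent[OF p q_def]
  define F where "F = (\<integral>x. norm (f x) powr p \<partial>M)"
  define G where "G n = (\<integral>x. norm (g n x) powr p \<partial>M)" for n
  define d where "d n = (\<integral>x. norm (g n x - f x) powr p \<partial>M)" for n
  define B where "B n = 2 powr p * (d n + F)" for n
  have nn: "0 \<le> F" "0 \<le> G n" "0 \<le> d n" for n
    unfolding F_def G_def d_def by (auto intro!: integral_nonneg_AE)
  have "1 \<le> 2 powr p" using p by (intro ge_one_powr_ge_zero) auto
  then have FB: "F \<le> B n" for n
    unfolding B_def using nn mult_mono[of 1 "2 powr p" F "d n + F"] by simp
  have gf: "(\<lambda>x. g n x - f x) \<in> Lp_functions M p" for n
    using p f g by (intro Lp_functions_diff) auto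
  have GB: "G n \<le> B n" for n
  proof -
    have "G n \<le> (\<integral>x. 2 powr p * (norm (g n x - f x) powr p + norm (f x) powr p) \<partial>M)"
      unfolding G_def
    proof (rule integral_mono)
      show "norm (g n x) powr p \<le> 2 powr p * (norm (g n x - f x) powr p + norm (f x) powr p)" for x
        using norm_powr_add_le[of p "g n x - f x" "f x"] p by simp
    qed (use Lp_functions_integrable[OF f] Lp_functions_integrable[OF g]
          Lp_functions_integrable[OF gf] in auto)
    also have "\<dots> = B n"
      using Lp_functions_integrable[OF f] Lp_functions_integrable[OF gf]
      by (simp add: B_def d_def F_def)
    finally show ?thesis .
  qed
  have bound: "norm (G n - F) \<le> p * B n powr (1 / q) * d n powr (1 / p)" for n
  proof -
    have mono: "p * X powr (1 / q) * d n powr (1 / p) \<le> p * B n powr (1 / q) * d n powr (1 / p)"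
      if "0 \<le> X" "X \<le> B n" for X
      using that p e by (intro mult_right_mono mult_left_mono powr_mono2) auto
    have "F - G n \<le> p * F powr (1 / q) * d n powr (1 / p)"
      using Lp_power_diff_le[OF p q_def f g] by (simp add: F_def G_def d_def)
    moreover have "G n - F \<le> p * G n powr (1 / q) * d n powr (1 / p)"
      using Lp_power_diff_le[OF p q_def g f] by (simp add: F_def G_def d_def norm_minus_commute)
    ultimately show ?thesis using mono[OF nn(1) FB] mono[OF nn(2) GB] by (simp add: abs_le_iff)
  qed
  have d0: "d \<longlonglongrightarrow> 0" using lim by (simp add: d_def[abs_def])
  have "(\<lambda>n. p * B n powr (1 / q) * d n powr (1 / p)) \<longlonglongrightarrow> p * (2 powr p * (0 + F)) powr (1 / q) * 0 powr (1 / p)"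
    unfolding B_def using p e(1) nn d0
    by (intro tendsto_intros tendsto_powr') (auto intro!: always_eventually add_nonneg_nonneg)
  then have "(\<lambda>n. p * B n powr (1 / q) * d n powr (1 / p)) \<longlonglongrightarrow> 0" by simp
  then have "(\<lambda>n. G n - F) \<longlonglongrightarrow> 0"
    by (rule Lim_null_comparison[rotated]) (use bound in auto)
  then show ?thesis using LIM_zero_iff[of G F] by (simp add: G_def[abs_def] F_def)
qed

lemma Holder_pairing_tendsto:
  assumes p: "1 < p" and q: "q = p / (p - 1)" and k: "k \<in> Lp_functions M q"
    and f: "f \<in> Lp_functions M p" and g: "\<And>n::nat. g n \<in> Lp_functions M p"
    and lim: "(\<lambda>n. \<integral>x. norm (g n x - f x) powr p \<partial>M) \<longlonglongrightarrow> 0"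
  shows "(\<lambda>n. \<integral>x. g n x * k x \<partial>M) \<longlonglongrightarrow> (\<integral>x. f x * k x \<partial>M)"
proof -
  have gf: "(\<lambda>x. g n x - f x) \<in> Lp_functions M p" for n
    using p f g by (intro Lp_functions_diff) auto
  let ?K = "(\<integral>x. norm (k x) powr q \<partial>M) powr (1 / q)"
  have bound: "norm ((\<integral>x. g n x * k x \<partial>M) - (\<integral>x. f x * k x \<partial>M))
      \<le> (\<integral>x. norm (g n x - f x) powr p \<partial>M) powr (1 / p) * ?K" for n
    using Holder_inequality[OF p q gf k] Holder_integrable[OF p q f k] Holder_integrable[OF p q g k]
    by (simp add: left_diff_distrib)
  have "(\<lambda>n. (\<integral>x. norm (g n x - f x) powr p \<partial>M) powr (1 / p) * ?K) \<longlonglongrightarrow> 0 powr (1 / p) * ?K"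
    using p lim by (intro tendsto_mult tendsto_powr' tendsto_const)
      (auto intro!: always_eventually integral_nonneg_AE)
  then have "(\<lambda>n. (\<integral>x. norm (g n x - f x) powr p \<partial>M) powr (1 / p) * ?K) \<longlonglongrightarrow> 0"
    by simp
  then have "(\<lambda>n. (\<integral>x. g n x * k x \<partial>M) - (\<integral>x. f x * k x \<partial>M)) \<longlonglongrightarrow> 0"
    by (rule Lim_null_comparison[OF always_eventually[OF allI[OF bound]]])
  then show ?thesis by (rule LIM_zero_cancel)
qed

section \<open>Best approximation in Lp of a finite measure\<close>

lemma (in finite_measure) constant_Lp: "(\<lambda>x. c) \<in> Lp_functions M p"
  by (simp add: Lp_functions_def)

lemma (in finite_measure) Lp_functions_imp_integrable:
  assumes p: "1 < p" and f: "f \<in> Lp_functions M p"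
  shows "integrable M f"
  using Holder_integrable[OF p refl f constant_Lp[of 1]] by simp

text \<open>On a finite measure space a Cauchy sequence in \<open>L\<^sup>p\<close> is Cauchy in \<open>L\<^sup>1\<close>, by Hoelder's
  inequality against the constant 1, so a subsequence converges almost everywhere. Fatou's
  lemma along that subsequence bounds the distance of each \<open>f n\<close> from the pointwise limit.\<close>

lemma (in finite_measure) Lp_complete:
  fixes f :: "nat \<Rightarrow> 'a \<Rightarrow> complex"
  assumes p: "1 < p" and f: "\<And>n. f n \<in> Lp_functions M p"
    and cauchy: "\<And>e. 0 < e \<Longrightarrow> \<exists>N. \<forall>i\<ge>N. \<forall>j\<ge>N. (\<integral>x. norm (f i x - f j x) powr p \<partial>M) < e"
  obtains u where "u \<in> Lp_functions M p"
    and "(\<lambda>n. \<integral>x. norm (f n x - u x) powr p \<partial>M) \<longlonglongrightarrow> 0"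
proof -
  define q where "q = p / (p - 1)"
  note [measurable] = Lp_functions_measurable[OF f]
  have diff: "(\<lambda>x. f i x - f j x) \<in> Lp_functions M p" for i j
    using p f by (intro Lp_functions_diff) auto
  define m where "m = measure M (space M) powr (1 / q)"
  have L1: "(\<integral>x. norm (f i x - f j x) \<partial>M) \<le> (\<integral>x. norm (f i x - f j x) powr p \<partial>M) powr (1 / p) * m" for i j
  proof -
    have "(\<lambda>x. complex_of_real (norm (f i x - f j x))) \<in> Lp_functions M p"
      using Lp_functions_integrable[OF diff] by (simp add: Lp_functions_def)
    from Holder_inequality[OF p q_def this constant_Lp[of 1]]
    have "norm (\<integral>x. complex_of_real (norm (f i x - f j x)) \<partial>M)
        \<le> (\<integral>x. norm (f i x - f j x) powr p \<partial>M) powr (1 / p) * m"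
      by (simp add: m_def)
    then show ?thesis
      unfolding integral_complex_of_real norm_of_real by linarith
  qed
  obtain r where r: "strict_mono r" "AE x in M. Cauchy (\<lambda>i. f (r i) x)"
  proof (rule cauchy_L1_AE_cauchy_subseq[of M f])
    show "integrable M (f n)" for n by (rule Lp_functions_imp_integrable[OF p f])
    fix e :: real assume e: "0 < e"
    \<comment> \<open>\<open>m + 1\<close> instead of \<open>m\<close>, which is 0 for the zero measure.\<close>
    define \<delta> where "\<delta> = (e / (m + 1)) powr p"
    have m: "0 \<le> m" by (simp add: m_def)
    have \<delta>: "0 < \<delta>" "\<delta> powr (1 / p) = e / (m + 1)"
      using e m p by (auto simp: \<delta>_def powr_powr)
    obtain N where N: "\<And>i j. i \<ge> N \<Longrightarrow> j \<ge> N \<Longrightarrow> (\<integral>x. norm (f i x - f j x) powr p \<partial>M) < \<delta>"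
      using cauchy[OF \<delta>(1)] by blast
    have "(\<integral>x. norm (f i x - f j x) \<partial>M) < e" if "i \<ge> N" "j \<ge> N" for i j
    proof -
      have "(\<integral>x. norm (f i x - f j x) powr p \<partial>M) powr (1 / p) \<le> \<delta> powr (1 / p)"
        using N[OF that] p by (intro powr_mono2) (auto intro!: integral_nonneg_AE)
      then have "(\<integral>x. norm (f i x - f j x) powr p \<partial>M) powr (1 / p) * m \<le> e / (m + 1) * m"
        using m unfolding \<delta>(2) by (rule mult_right_mono)
      also have "\<dots> < e" using m e by (simp add: field_simps)
      finally show ?thesis using L1[of i j] by linarith
    qed
    then show "\<exists>N. \<forall>i\<ge>N. \<forall>j\<ge>N. (\<integral>x. norm (f i x - f j x) \<partial>M) < e" by blast
  qed (use that in blast)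
  define u where "u x = lim (\<lambda>i. f (r i) x)" for x
  have um [measurable]: "u \<in> borel_measurable M" unfolding u_def by measurable
  have conv: "AE x in M. (\<lambda>i. f (r i) x) \<longlonglongrightarrow> u x"
    using r(2) by eventually_elim (simp add: u_def Cauchy_convergent_iff convergent_LIMSEQ_iff)
  have tail: "(\<integral>\<^sup>+x. ennreal (norm (f n x - u x) powr p) \<partial>M) \<le> ennreal e"
    if e: "0 < e" and N: "\<forall>i\<ge>N. \<forall>j\<ge>N. (\<integral>x. norm (f i x - f j x) powr p \<partial>M) < e"
      and n: "n \<ge> N" for e N n
  proof -
    have "AE x in M. ennreal (norm (f n x - u x) powr p)
        = liminf (\<lambda>k. ennreal (norm (f n x - f (r k) x) powr p))"
      using conv
    proof eventually_elim
      case (elim x)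
      have "(\<lambda>k. norm (f n x - f (r k) x) powr p) \<longlonglongrightarrow> norm (f n x - u x) powr p"
        using p elim by (intro tendsto_powr' tendsto_intros) auto
      then have "(\<lambda>k. ennreal (norm (f n x - f (r k) x) powr p)) \<longlonglongrightarrow> ennreal (norm (f n x - u x) powr p)"
        by (rule tendsto_ennrealI)
      then show ?case using lim_imp_Liminf[OF trivial_limit_sequentially] by metis
    qed
    then have "(\<integral>\<^sup>+x. ennreal (norm (f n x - u x) powr p) \<partial>M)
        = (\<integral>\<^sup>+x. liminf (\<lambda>k. ennreal (norm (f n x - f (r k) x) powr p)) \<partial>M)"
      by (rule nn_integral_cong_AE)
    also have "\<dots> \<le> liminf (\<lambda>k. \<integral>\<^sup>+x. ennreal (norm (f n x - f (r k) x) powr p) \<partial>M)"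
      by (rule nn_integral_liminf) measurable
    also have "\<dots> \<le> ennreal e"
    proof (rule Liminf_le)
      show "\<forall>\<^sub>F k in sequentially. (\<integral>\<^sup>+x. ennreal (norm (f n x - f (r k) x) powr p) \<partial>M) \<le> ennreal e"
        using eventually_ge_at_top[of N]
      proof eventually_elim
        case (elim k)
        then have "N \<le> r k" using strict_mono_imp_increasing[OF r(1), of k] by simp
        then have "(\<integral>x. norm (f n x - f (r k) x) powr p \<partial>M) \<le> e"
          using N n less_imp_le by blast
        then show ?case
          using Lp_functions_integrable[OF diff[of n "r k"]]
          by (subst nn_integral_eq_integral) (auto intro!: ennreal_leI)
      qed
    qed simp
    finally show ?thesis .
  qed
  have diffu: "(\<lambda>x. f n x - u x) \<in> Lp_functions M p" if "0 < e" "n \<ge> N"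
    "\<forall>i\<ge>N. \<forall>j\<ge>N. (\<integral>x. norm (f i x - f j x) powr p \<partial>M) < e" for e N n
  proof -
    have "integrable M (\<lambda>x. norm (f n x - u x) powr p)"
      using tail[OF that(1,3,2)] by (intro integrableI_bounded) (auto simp: le_less_trans[OF _ ennreal_less_top])
    then show ?thesis by (simp add: Lp_functions_def)
  qed
  show ?thesis
  proof
    obtain N where N: "\<forall>i\<ge>N. \<forall>j\<ge>N. (\<integral>x. norm (f i x - f j x) powr p \<partial>M) < 1"
      using cauchy[OF zero_less_one] by blast
    show "u \<in> Lp_functions M p"
      using Lp_functions_diff[OF _ f[of N] diffu[OF zero_less_one order_refl N]] p by simp
    show "(\<lambda>n. \<integral>x. norm (f n x - u x) powr p \<partial>M) \<longlonglongrightarrow> 0"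
    proof (rule LIMSEQ_I)
      fix e :: real assume e: "0 < e"
      then obtain N where N: "\<forall>i\<ge>N. \<forall>j\<ge>N. (\<integral>x. norm (f i x - f j x) powr p \<partial>M) < e / 2"
        using cauchy[OF half_gt_zero[OF e]] by blast
      have "norm ((\<integral>x. norm (f n x - u x) powr p \<partial>M) - 0) < e" if n: "n \<ge> N" for n
      proof -
        have "ennreal (\<integral>x. norm (f n x - u x) powr p \<partial>M) \<le> ennreal (e / 2)"
          using tail[OF half_gt_zero[OF e] N n]
            Lp_functions_integrable[OF diffu[OF half_gt_zero[OF e] n N]]
          by (simp add: nn_integral_eq_integral)
        then have "(\<integral>x. norm (f n x - u x) powr p \<partial>M) \<le> e / 2" using e by (simp add: ennreal_le_iff)
        moreover have "0 \<le> (\<integral>x. norm (f n x - u x) powr p \<partial>M)" by (auto intro!: integral_nonneg_AE)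
        ultimately show ?thesis using e by simp
      qed
      then show "\<exists>N. \<forall>n\<ge>N. norm ((\<integral>x. norm (f n x - u x) powr p \<partial>M) - 0) < e" by blast
    qed
  qed
qed

text \<open>Near the minimum the midpoint cannot fall far below the mean, so the integrated
  \<open>norm_powr_uniform_convexity\<close> makes the sequence Cauchy.\<close>

lemma (in finite_measure) Lp_minimizing_sequence_converges:
  fixes f :: "nat \<Rightarrow> 'a \<Rightarrow> complex"
  assumes p: "1 < p" and f: "\<And>n. f n \<in> Lp_functions M p"
    and lim: "(\<lambda>n. \<integral>x. norm (f n x) powr p \<partial>M) \<longlonglongrightarrow> D"
    and mid: "\<And>i j. D \<le> (\<integral>x. norm ((f i x + f j x) / 2) powr p \<partial>M)"
  obtains u where "u \<in> Lp_functions M p"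
    and "(\<lambda>n. \<integral>x. norm (f n x - u x) powr p \<partial>M) \<longlonglongrightarrow> 0"
proof (rule Lp_complete[OF p f])
  fix \<epsilon> :: real assume \<epsilon>: "0 < \<epsilon>"
  define I where "I n = (\<integral>x. norm (f n x) powr p \<partial>M)" for n
  have I0: "0 \<le> I n" for n unfolding I_def by (auto intro!: integral_nonneg_AE)
  have "0 \<le> D" using lim I0 by (intro LIMSEQ_le_const) (auto simp: I_def)
  \<comment> \<open>The two error terms must be at most \<open>\<epsilon> / 2\<close> each: \<open>\<delta> \<le> 1\<close> bounds both integrals by \<open>D + 1\<close>.\<close>
  define e where "e = \<epsilon> / (4 * (D + 1))"
  have e: "0 < e" using \<epsilon> \<open>0 \<le> D\<close> by (simp add: e_def)
  obtain C where C: "0 < C" "\<And>a b :: complex. norm (a - b) powr p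
      \<le> e * (norm a powr p + norm b powr p)
        + C * ((norm a powr p + norm b powr p) / 2 - norm ((a + b) / 2) powr p)"
    using norm_powr_uniform_convexity[OF p e] by blast
  define \<delta> where "\<delta> = min 1 (\<epsilon> / (2 * C))"
  have \<delta>: "0 < \<delta>" using \<epsilon> C by (simp add: \<delta>_def)
  have "eventually (\<lambda>n. I n < D + \<delta>) sequentially"
    using order_tendstoD(2)[OF lim, of "D + \<delta>"] \<delta> by (simp add: I_def)
  then obtain N where N: "\<And>n. n \<ge> N \<Longrightarrow> I n < D + \<delta>" by (auto simp: eventually_sequentially)
  have "(\<integral>x. norm (f i x - f j x) powr p \<partial>M) < \<epsilon>" if ij: "i \<ge> N" "j \<ge> N" for i j
  proof -
    have "(\<lambda>x. f i x - f j x) \<in> Lp_functions M p" using p f by (intro Lp_functions_diff) auto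
    note id = Lp_functions_integrable[OF this]
    have "(\<lambda>x. 1 / 2 * (f i x + f j x)) \<in> Lp_functions M p"
      using p f by (intro Lp_functions_scale Lp_functions_add) auto
    note im = Lp_functions_integrable[OF this, simplified]
    note int = Lp_functions_integrable[OF f[of i]] Lp_functions_integrable[OF f[of j]]
    have "(\<integral>x. norm (f i x - f j x) powr p \<partial>M)
       \<le> (\<integral>x. e * (norm (f i x) powr p + norm (f j x) powr p)
            + C * ((norm (f i x) powr p + norm (f j x) powr p) / 2 - norm ((f i x + f j x) / 2) powr p) \<partial>M)"
      using C(2) id im int by (intro integral_mono) auto
    also have "\<dots> = e * (I i + I j) + C * ((I i + I j) / 2 - (\<integral>x. norm ((f i x + f j x) / 2) powr p \<partial>M))"
      using int im by (simp add: I_def)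
    also have "\<dots> \<le> e * (I i + I j) + C * \<delta>"
    proof -
      have "(I i + I j) / 2 \<le> D + \<delta>" using N[OF ij(1)] N[OF ij(2)] by simp
      then have "(I i + I j) / 2 - (\<integral>x. norm ((f i x + f j x) / 2) powr p \<partial>M) \<le> \<delta>"
        using mid[of i j] by linarith
      then show ?thesis using C(1) by (intro add_left_mono mult_left_mono) auto
    qed
    also have "\<dots> < e * (2 * (D + 1)) + C * (\<epsilon> / (2 * C))"
      using N[OF ij(1)] N[OF ij(2)] e C(1)
      by (intro add_less_le_mono mult_strict_left_mono mult_left_mono) (auto simp: \<delta>_def)
    also have "\<dots> = \<epsilon>" using C(1) \<open>0 \<le> D\<close> by (simp add: e_def field_simps)
    finally show ?thesis .
  qed
  then show "\<exists>N. \<forall>i\<ge>N. \<forall>j\<ge>N. (\<integral>x. norm (f i x - f j x) powr p \<partial>M) < \<epsilon>" by blast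
qed (use that in blast)

lemma Re_of_real_mult: "Re (of_real r * z) = r * Re z"
  by simp

text \<open>The tangent inequality at \<open>v = u - r s\<close> (not at \<open>u\<close>), with \<open>r > 0\<close> and \<open>s = \<omega> t\<close>, together
  with minimality of \<open>u\<close> gives \<open>Re \<integral> s * duality_map p v \<le> 0\<close>. Let \<open>r\<close> tend to 0 by dominated
  convergence; as the complex factor \<open>\<omega>\<close> is arbitrary, the integral vanishes. Hence the \<open>L\<^sup>p\<close> norm
  need not be differentiated under the integral.\<close>

lemma duality_map_orthogonal:
  assumes p: "1 < p" and u: "u \<in> Lp_functions M p" and t: "t \<in> Lp_functions M p"
    and min: "\<And>c. (\<integral>x. norm (u x) powr p \<partial>M) \<le> (\<integral>x. norm (u x - c * t x) powr p \<partial>M)"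
  shows "(\<integral>x. t x * duality_map p (u x) \<partial>M) = 0"
proof -
  define q where "q = p / (p - 1)"
  note e = conjugate_exponent[OF p q_def]
  note [measurable] = Lp_functions_measurable[OF u] Lp_functions_measurable[OF t]
    duality_map_measurable[OF p]
  have le: "Re (\<integral>x. (\<omega> * t x) * duality_map p (u x) \<partial>M) \<le> 0" for \<omega> :: complex
  proof -
    define s where "s x = \<omega> * t x" for x
    have s: "s \<in> Lp_functions M p" unfolding s_def[abs_def] by (rule Lp_functions_scale[OF t])
    note [measurable] = Lp_functions_measurable[OF s]
    define v where "v n x = u x - of_real (1 / real (Suc n)) * s x" for n x
    have v: "v n \<in> Lp_functions M p" for n
      unfolding v_def[abs_def] using p u s by (intro Lp_functions_diff Lp_functions_scale) auto
    note [measurable] = Lp_functions_measurable[OF v]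
    have neg: "Re (\<integral>x. s x * duality_map p (v n x) \<partial>M) \<le> 0" for n
    proof -
      define r where "r = 1 / real (Suc n)"
      have r: "0 < r" by (simp add: r_def)
      let ?J = "\<lambda>x. s x * duality_map p (v n x)"
      have int: "integrable M ?J"
        by (rule Holder_integrable[OF p q_def s duality_map_Lp(1)[OF p q_def v]])
      have tangent: "norm (v n x) powr p + p * r * Re (?J x) \<le> norm (u x) powr p" for x
      proof -
        have "u x - v n x = of_real r * s x" by (simp add: v_def r_def)
        then have "duality_map p (v n x) * (u x - v n x) = of_real r * ?J x" by simp
        then have "Re (duality_map p (v n x) * (u x - v n x)) = r * Re (?J x)"
          by (simp only: Re_of_real_mult)
        then show ?thesis using norm_powr_tangent_le[OF p, of "v n x" "u x"] by (simp only: mult.assoc)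
      qed
      have "(\<integral>x. norm (v n x) powr p \<partial>M) + p * r * Re (\<integral>x. ?J x \<partial>M)
          = (\<integral>x. norm (v n x) powr p + p * r * Re (?J x) \<partial>M)"
        using int Lp_functions_integrable[OF v] by (simp del: times_complex.sel)
      also have "\<dots> \<le> (\<integral>x. norm (u x) powr p \<partial>M)"
      proof (rule integral_mono)
        show "integrable M (\<lambda>x. norm (v n x) powr p + p * r * Re (?J x))"
          using Lp_functions_integrable[OF v] int
          by (intro Bochner_Integration.integrable_add integrable_mult_right integrable_Re)
      qed (use tangent Lp_functions_integrable[OF u] in blast)+
      also have "\<dots> \<le> (\<integral>x. norm (v n x) powr p \<partial>M)"
        using min[of "of_real r * \<omega>"] by (simp add: v_def s_def r_def mult.assoc)
      finally have "p * r * Re (\<integral>x. ?J x \<partial>M) \<le> 0" by simp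
      then show ?thesis using p r by (simp add: mult_le_0_iff)
    qed
    have "(\<lambda>n. \<integral>x. s x * duality_map p (v n x) \<partial>M) \<longlonglongrightarrow> (\<integral>x. s x * duality_map p (u x) \<partial>M)"
    proof (rule integral_dominated_convergence)
      \<comment> \<open>Young's inequality, and \<open>\<bar>v n\<bar> \<le> \<bar>u\<bar> + \<bar>s\<bar>\<close> for every \<open>n\<close>.\<close>
      let ?w = "\<lambda>x. norm (s x) powr p + 2 powr p * (norm (u x) powr p + norm (s x) powr p)"
      show "integrable M ?w"
        using Lp_functions_integrable[OF u] Lp_functions_integrable[OF s] by simp
      show "AE x in M. (\<lambda>n. s x * duality_map p (v n x)) \<longlonglongrightarrow> s x * duality_map p (u x)"
      proof (rule AE_I2)
        fix x
        have "(\<lambda>n. u x - of_real (1 / real (Suc n)) * s x) \<longlonglongrightarrow> u x - of_real 0 * s x"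
          by (intro tendsto_intros LIMSEQ_Suc[OF lim_1_over_n])
        then have "(\<lambda>n. v n x) \<longlonglongrightarrow> u x" by (simp add: v_def)
        then show "(\<lambda>n. s x * duality_map p (v n x)) \<longlonglongrightarrow> s x * duality_map p (u x)"
          by (intro tendsto_mult tendsto_const isCont_tendsto_compose[OF isCont_duality_map[OF p]])
      qed
      show "AE x in M. norm (s x * duality_map p (v n x)) \<le> ?w x" for n
      proof (rule AE_I2)
        fix x
        have "norm (s x * duality_map p (v n x))
            \<le> norm (s x) powr p / p + norm (duality_map p (v n x)) powr q / q"
          using Youngs_inequality[OF _ e(1) e(2)] p by (simp add: norm_mult)
        also have "\<dots> \<le> norm (s x) powr p + norm (v n x) powr p"
          unfolding duality_map_Lp(2)[OF p q_def v] using p e(1)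
          by (intro add_mono) (auto simp: divide_le_eq mult_le_cancel_left1)
        also have "norm (v n x) powr p \<le> 2 powr p * (norm (u x) powr p + norm (s x) powr p)"
        proof -
          have "norm (of_real (1 / real (Suc n)) * s x) \<le> norm (s x)"
            unfolding norm_mult norm_of_real by (intro mult_left_le_one_le) auto
          then have "norm (v n x) \<le> norm (u x) + norm (s x)"
            unfolding v_def by (rule order_trans[OF norm_triangle_ineq4 add_left_mono])
          then have "norm (v n x) powr p \<le> norm (norm (u x) + norm (s x)) powr p"
            using p by (intro powr_mono2) auto
          also have "\<dots> \<le> 2 powr p * (norm (u x) powr p + norm (s x) powr p)"
            using norm_powr_add_le[of p "norm (u x)" "norm (s x)"] p by simp
          finally show ?thesis .
        qed
        finally show "norm (s x * duality_map p (v n x)) \<le> ?w x" by simp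
      qed
    qed measurable
    then have "(\<lambda>n. Re (\<integral>x. s x * duality_map p (v n x) \<partial>M)) \<longlonglongrightarrow> Re (\<integral>x. s x * duality_map p (u x) \<partial>M)"
      by (rule tendsto_Re)
    then have "Re (\<integral>x. s x * duality_map p (u x) \<partial>M) \<le> 0"
      by (rule LIMSEQ_le_const2) (use neg in blast)
    then show ?thesis by (simp add: s_def)
  qed
  \<comment> \<open>With \<open>\<omega>\<close> the conjugate of the integral, the inequality reads \<open>\<bar>Z\<bar>\<^sup>2 \<le> 0\<close>.\<close>
  define Z where "Z = (\<integral>x. t x * duality_map p (u x) \<partial>M)"
  have "(\<integral>x. (cnj Z * t x) * duality_map p (u x) \<partial>M) = cnj Z * Z"
    unfolding Z_def mult.assoc by simp
  then have "Re (cnj Z * Z) \<le> 0" using le[of "cnj Z"] by metis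
  then show ?thesis unfolding Z_def[symmetric]
    by (simp add: complex_eq_iff sum_power2_le_zero_iff flip: power2_eq_square)
qed

text \<open>The function \<open>g\<close> is the duality map of \<open>u\<close>, the \<open>L\<^sup>p\<close> limit of a minimizing sequence
  \<open>f - \<tau> n\<close>. The residual \<open>u\<close> exists although \<open>T\<close> need not be closed; since \<open>g\<close> annihilates every
  \<open>\<tau> n\<close>, it pairs with \<open>f\<close> as it does with \<open>u\<close>.\<close>

theorem (in finite_measure) Lp_distance_dual_functional:
  assumes p: "1 < p" and q: "q = p / (p - 1)"
    and f: "f \<in> Lp_functions M p" and T: "T \<subseteq> Lp_functions M p"
    and zero: "(\<lambda>x. 0) \<in> T"
    and add: "\<And>t t'. t \<in> T \<Longrightarrow> t' \<in> T \<Longrightarrow> (\<lambda>x. t x + t' x) \<in> T"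
    and scale: "\<And>t c. t \<in> T \<Longrightarrow> (\<lambda>x. c * t x) \<in> T"
    and D: "D = (INF t\<in>T. \<integral>x. norm (f x - t x) powr p \<partial>M)"
  obtains g where "g \<in> Lp_functions M q" and "(\<integral>x. norm (g x) powr q \<partial>M) = D"
    and "\<And>t. t \<in> T \<Longrightarrow> (\<integral>x. t x * g x \<partial>M) = 0" and "(\<integral>x. f x * g x \<partial>M) = of_real D"
proof -
  define E where "E t = (\<integral>x. norm (f x - t x) powr p \<partial>M)" for t
  have bdd: "bdd_below (E ` T)"
    by (rule bdd_belowI[of _ 0]) (auto simp: E_def intro!: integral_nonneg_AE)
  have DE: "D \<le> E t" if "t \<in> T" for t
    unfolding D E_def[symmetric] using bdd that by (rule cINF_lower)
  have "\<exists>t\<in>T. E t < D + 1 / real (Suc n)" for n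
    using cINF_less_iff[OF _ bdd, of "D + 1 / real (Suc n)"] zero by (auto simp: D E_def[symmetric])
  then obtain \<tau> where \<tau>: "\<And>n. \<tau> n \<in> T" "\<And>n. E (\<tau> n) < D + 1 / real (Suc n)" by metis
  have Elim: "(\<lambda>n. E (\<tau> n)) \<longlonglongrightarrow> D"
  proof (rule tendsto_sandwich[where f = "\<lambda>_. D"])
    show "(\<lambda>n. D + 1 / real (Suc n)) \<longlonglongrightarrow> D"
      using tendsto_add[OF tendsto_const LIMSEQ_Suc[OF lim_1_over_n], of D] by simp
  qed (use DE \<tau> less_imp_le in \<open>blast intro: always_eventually tendsto_const\<close>)+
  define F where "F n x = f x - \<tau> n x" for n x
  have F: "F n \<in> Lp_functions M p" for n
    unfolding F_def[abs_def] using p f T \<tau> by (intro Lp_functions_diff) auto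
  obtain u where u: "u \<in> Lp_functions M p" and lim: "(\<lambda>n. \<integral>x. norm (F n x - u x) powr p \<partial>M) \<longlonglongrightarrow> 0"
  proof (rule Lp_minimizing_sequence_converges[OF p F])
    show "(\<lambda>n. \<integral>x. norm (F n x) powr p \<partial>M) \<longlonglongrightarrow> D" using Elim by (simp add: E_def F_def)
    have "(\<lambda>x. 1 / 2 * (\<tau> i x + \<tau> j x)) \<in> T" for i j by (intro scale add \<tau>)
    from DE[OF this] show "D \<le> (\<integral>x. norm ((F i x + F j x) / 2) powr p \<partial>M)" for i j
      by (simp add: E_def F_def field_simps)
  qed (use that in blast)
  have "(\<lambda>n. \<integral>x. norm (F n x) powr p \<partial>M) \<longlonglongrightarrow> (\<integral>x. norm (u x) powr p \<partial>M)"
    by (rule Lp_power_tendsto[OF p u F lim])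
  with Elim have uD: "(\<integral>x. norm (u x) powr p \<partial>M) = D"
    by (intro LIMSEQ_unique) (auto simp: E_def F_def)
  have min: "D \<le> (\<integral>x. norm (u x - t x) powr p \<partial>M)" if t: "t \<in> T" for t
  proof -
    have "t \<in> Lp_functions M p" using t T by auto
    then have "(\<lambda>n. \<integral>x. norm (F n x - t x) powr p \<partial>M) \<longlonglongrightarrow> (\<integral>x. norm (u x - t x) powr p \<partial>M)"
      using p u F lim by (intro Lp_power_tendsto Lp_functions_diff) auto
    moreover have "D \<le> (\<integral>x. norm (F n x - t x) powr p \<partial>M)" for n
      using DE[OF add[OF \<tau>(1)[of n] t]] by (simp add: E_def F_def algebra_simps)
    ultimately show ?thesis by (intro LIMSEQ_le_const) auto
  qed
  define g where "g x = duality_map p (u x)" for x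
  have g: "g \<in> Lp_functions M q" unfolding g_def[abs_def] by (rule duality_map_Lp[OF p q u])
  have orth: "(\<integral>x. t x * g x \<partial>M) = 0" if "t \<in> T" for t
    unfolding g_def using p u T that min[OF scale[OF that]]
    by (intro duality_map_orthogonal) (auto simp: uD)
  have "(\<integral>x. F n x * g x \<partial>M) = (\<integral>x. f x * g x \<partial>M)" for n
  proof -
    have "\<tau> n \<in> Lp_functions M p" using T \<tau> by auto
    then show ?thesis
      using orth[OF \<tau>(1)[of n]] Holder_integrable[OF p q f g] Holder_integrable[OF p q _ g, of "\<tau> n"]
      by (simp add: F_def left_diff_distrib)
  qed
  then have "(\<integral>x. f x * g x \<partial>M) = (\<integral>x. u x * g x \<partial>M)"
    using Holder_pairing_tendsto[OF p q g u F lim] LIMSEQ_unique[OF tendsto_const] by simp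
  also have "\<dots> = (\<integral>x. of_real (norm (u x) powr p) \<partial>M)"
    unfolding g_def using duality_map_times_self by (simp add: mult.commute)
  also have "\<dots> = of_real D" unfolding uD[symmetric] by (rule integral_complex_of_real)
  finally have "(\<integral>x. f x * g x \<partial>M) = of_real D" .
  moreover have "(\<integral>x. norm (g x) powr q \<partial>M) = D"
    unfolding g_def duality_map_Lp(2)[OF p q u] by (rule uD)
  ultimately show ?thesis using that g orth by blast
qed

section \<open>Characters and trigonometric polynomials\<close>

text \<open>Evaluation at \<open>x\<close> is continuous in the compact-open topology, as \<open>{x}\<close> is compact.\<close>

lemma chi_measurable [measurable]:
  "chi (x :: 'a::topological_ab_group_add) \<in> borel_measurable borel"
proof -
  have "open (chi x -` U)" if "open U" for U :: "complex set"
  proof -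
    have "chi x -` U = {\<gamma> :: 'a dual_group. pairing \<gamma> ` {x} \<subseteq> U}" by (auto simp: chi_def)
    moreover have "open {\<gamma> :: 'a dual_group. pairing \<gamma> ` {x} \<subseteq> U}"
      unfolding open_dual_group_def
      by (rule generate_topology.Basis, rule CollectI, rule exI[of _ "{x}"], rule exI[of _ U])
        (simp add: that)
    ultimately show ?thesis by simp
  qed
  then have "continuous_on UNIV (chi x)" by (simp add: continuous_on_open_vimage)
  then show ?thesis by (rule borel_measurable_continuous_onI)
qed

lemma norm_chi [simp]: "norm (chi x \<gamma>) = 1"
  using pairing[of \<gamma>] by (simp add: chi_def is_character_def)

lemma chi_in_trig_polys: "x \<in> X \<Longrightarrow> chi x \<in> trig_polys X"
  unfolding trig_polys_def
  by (rule CollectI, rule exI[of _ "1::nat"], rule exI[of _ "\<lambda>_. 1"], rule exI[of _ "\<lambda>_. x"]) auto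

lemma zero_in_trig_polys: "(\<lambda>_. 0) \<in> trig_polys X"
  unfolding trig_polys_def by (rule CollectI, rule exI[of _ "0::nat"]) auto

lemma trig_polys_scale: "t \<in> trig_polys X \<Longrightarrow> (\<lambda>\<gamma>. c * t \<gamma>) \<in> trig_polys X"
proof -
  assume "t \<in> trig_polys X"
  then obtain n u x where t: "t = (\<lambda>\<gamma>. \<Sum>j<(n::nat). u j * chi (x j) \<gamma>)" "\<forall>j<n. x j \<in> X"
    unfolding trig_polys_def by blast
  then show ?thesis unfolding trig_polys_def
    by (intro CollectI exI[of _ n] exI[of _ "\<lambda>j. c * u j"] exI[of _ x])
      (auto simp: sum_distrib_left mult.assoc)
qed

text \<open>Concatenate the two families of coefficients and frequencies.\<close>

lemma trig_polys_add:
  assumes "t \<in> trig_polys X" and "t' \<in> trig_polys X"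
  shows "(\<lambda>\<gamma>. t \<gamma> + t' \<gamma>) \<in> trig_polys X"
proof -
  obtain n u x where t: "t = (\<lambda>\<gamma>. \<Sum>j<(n::nat). u j * chi (x j) \<gamma>)" "\<forall>j<n. x j \<in> X"
    using assms(1) unfolding trig_polys_def by blast
  obtain m v y where t': "t' = (\<lambda>\<gamma>. \<Sum>j<(m::nat). v j * chi (y j) \<gamma>)" "\<forall>j<m. y j \<in> X"
    using assms(2) unfolding trig_polys_def by blast
  define a where "a j = (if j < n then u j else v (j - n))" for j
  define z where "z j = (if j < n then x j else y (j - n))" for j
  have "(\<Sum>j<n + m. a j * chi (z j) \<gamma>)
      = (\<Sum>j<n. u j * chi (x j) \<gamma>) + (\<Sum>j<m. v j * chi (y j) \<gamma>)" for \<gamma>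
  proof -
    have "(\<Sum>j<n + m. a j * chi (z j) \<gamma>)
        = (\<Sum>j<n. a j * chi (z j) \<gamma>) + (\<Sum>j<m. a (n + j) * chi (z (n + j)) \<gamma>)"
      by (induction m) (auto simp: add.assoc)
    then show ?thesis by (simp add: a_def z_def)
  qed
  moreover have "\<forall>j<n + m. z j \<in> X" using t(2) t'(2) by (auto simp: z_def)
  ultimately show ?thesis unfolding trig_polys_def t(1) t'(1)
    by (intro CollectI exI[of _ "n + m"] exI[of _ a] exI[of _ z]) (auto simp: fun_eq_iff)
qed

lemma trig_polys_induct [consumes 1, case_names zero add]:
  assumes "t \<in> trig_polys X" and zero: "P (\<lambda>_. 0)"
    and add: "\<And>t u x. P t \<Longrightarrow> x \<in> X \<Longrightarrow> P (\<lambda>\<gamma>. t \<gamma> + u * chi x \<gamma>)"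
  shows "P t"
proof -
  obtain n u x where t: "t = (\<lambda>\<gamma>. \<Sum>j<(n::nat). u j * chi (x j) \<gamma>)" "\<forall>j<n. x j \<in> X"
    using assms(1) unfolding trig_polys_def by blast
  have "P (\<lambda>\<gamma>. \<Sum>j<k. u j * chi (x j) \<gamma>)" if "k \<le> n" for k
    using that
  proof (induction k)
    case 0
    show ?case using zero by simp
  next
    case (Suc k)
    then show ?case using add[OF Suc.IH, of "x k" "u k"] t(2) by simp
  qed
  then show ?thesis unfolding t(1) by simp
qed

section \<open>The measure with density w and the space with the dual weight\<close>

lemma borel_measurable_cnj [measurable (raw)]:
  "f \<in> borel_measurable M \<Longrightarrow> (\<lambda>x. cnj (f x)) \<in> borel_measurable M"
  by (rule borel_measurable_continuous_on[of cnj]) (intro continuous_intros)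

locale integrable_weight =
  fixes \<mu> :: "'b::topological_space measure" and w :: "'b \<Rightarrow> real"
  assumes sets_mu: "sets \<mu> = sets borel"
    and w_measurable: "w \<in> borel_measurable borel"
    and w_nonneg: "0 \<le> w \<gamma>"
    and w_integrable: "integrable \<mu> w"
begin

definition weighted :: "'b measure" where
  "weighted = density \<mu> (\<lambda>\<gamma>. ennreal (w \<gamma>))"

lemma measurable_mu: "measurable \<mu> = measurable borel"
  using measurable_cong_sets[OF sets_mu refl] by auto

lemma measurable_weighted: "measurable weighted = measurable borel"
proof -
  have "sets weighted = sets borel" by (simp add: weighted_def sets_mu)
  from measurable_cong_sets[OF this refl] show ?thesis by auto
qed

sublocale weighted: finite_measure weighted
proof (rule finite_measureI)
  have "emeasure weighted (space weighted) = (\<integral>\<^sup>+\<gamma>. ennreal (w \<gamma>) \<partial>\<mu>)"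
    using w_measurable by (simp add: weighted_def emeasure_density measurable_mu cong: nn_integral_cong)
  also have "\<dots> = ennreal (\<integral>\<gamma>. w \<gamma> \<partial>\<mu>)"
    using w_integrable w_nonneg by (intro nn_integral_eq_integral) auto
  finally show "emeasure weighted (space weighted) \<noteq> \<infinity>" by simp
qed

lemma integral_weighted:
  fixes f :: "'b \<Rightarrow> 'c::{banach, second_countable_topology}"
  assumes "f \<in> borel_measurable borel"
  shows "integral\<^sup>L weighted f = (\<integral>\<gamma>. w \<gamma> *\<^sub>R f \<gamma> \<partial>\<mu>)"
  unfolding weighted_def using assms w_measurable w_nonneg
  by (intro integral_density) (auto simp: measurable_mu)

lemma integrable_weighted_iff:
  fixes f :: "'b \<Rightarrow> 'c::{banach, second_countable_topology}"
  assumes "f \<in> borel_measurable borel"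
  shows "integrable weighted f \<longleftrightarrow> integrable \<mu> (\<lambda>\<gamma>. w \<gamma> *\<^sub>R f \<gamma>)"
  unfolding weighted_def using assms w_measurable w_nonneg
  by (intro integrable_density) (auto simp: measurable_mu)

text \<open>This is \<open>w\<^sup>q (1/w)\<^bsup>q-1\<^esup> = w\<close>, and it makes \<open>g \<mapsto> w g\<^sup>*\<close> an isometry. Where \<open>w\<close> vanishes both
  sides are 0.\<close>

lemma w_plus_powr_identity:
  assumes "0 < q"
  shows "norm (of_real (w \<gamma>) * z :: complex) powr q * w_plus w \<gamma> powr (q - 1) = w \<gamma> * norm z powr q"
proof (cases "w \<gamma> = 0")
  case False
  with w_nonneg[of \<gamma>] have w: "0 < w \<gamma>" by simp
  have "w \<gamma> powr q * (1 / w \<gamma>) powr (q - 1) = w \<gamma>"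
    using w by (simp add: powr_divide powr_diff)
  then show ?thesis using w by (simp add: w_plus_def norm_mult powr_mult)
qed (use assms in simp)

lemma L_w_plus_I:
  assumes q: "0 < q" and g: "g \<in> Lp_functions weighted q"
  shows "(\<lambda>\<gamma>. of_real (w \<gamma>) * cnj (g \<gamma>)) \<in> L_w_plus \<mu> w q (q - 1)"
    and "(\<integral>\<gamma>. norm (of_real (w \<gamma>) * cnj (g \<gamma>)) powr q * w_plus w \<gamma> powr (q - 1) \<partial>\<mu>)
       = (\<integral>\<gamma>. norm (g \<gamma>) powr q \<partial>weighted)"
proof -
  have gm [measurable]: "g \<in> borel_measurable borel"
    using Lp_functions_measurable[OF g] by (simp add: measurable_weighted)
  note [measurable] = w_measurable
  have "integrable \<mu> (\<lambda>\<gamma>. w \<gamma> * norm (g \<gamma>) powr q)"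
    using Lp_functions_integrable[OF g] by (simp add: integrable_weighted_iff)
  then have "(\<integral>\<^sup>+\<gamma>. ennreal (w \<gamma> * norm (g \<gamma>) powr q) \<partial>\<mu>) < \<infinity>"
    using w_nonneg by (subst nn_integral_eq_integral) auto
  then show "(\<lambda>\<gamma>. of_real (w \<gamma>) * cnj (g \<gamma>)) \<in> L_w_plus \<mu> w q (q - 1)"
    unfolding L_w_plus_def using w_plus_powr_identity[OF q, of _ "cnj (g _)"] by simp
  show "(\<integral>\<gamma>. norm (of_real (w \<gamma>) * cnj (g \<gamma>)) powr q * w_plus w \<gamma> powr (q - 1) \<partial>\<mu>)
       = (\<integral>\<gamma>. norm (g \<gamma>) powr q \<partial>weighted)"
    unfolding w_plus_powr_identity[OF q] by (simp add: integral_weighted)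
qed

text \<open>Surjectivity of \<open>g \<mapsto> w g\<^sup>*\<close>: take \<open>g = w\<^sup>+ h\<^sup>*\<close>. The normalisation of \<open>h\<close> to vanish where
  \<open>w\<close> does is what makes \<open>h\<close> equal to \<open>w g\<^sup>*\<close> everywhere.\<close>

lemma L_w_plus_D:
  assumes q: "0 < q" and h: "h \<in> L_w_plus \<mu> w q (q - 1)"
  obtains g where "g \<in> Lp_functions weighted q" and "h = (\<lambda>\<gamma>. of_real (w \<gamma>) * cnj (g \<gamma>))"
proof
  define g where "g \<gamma> = of_real (w_plus w \<gamma>) * cnj (h \<gamma>)" for \<gamma>
  have [measurable]: "h \<in> borel_measurable borel" "w \<in> borel_measurable borel"
    using h w_measurable by (auto simp: L_w_plus_def)
  have [measurable]: "w_plus w \<in> borel_measurable borel" unfolding w_plus_def[abs_def] by measurable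
  have gm [measurable]: "g \<in> borel_measurable borel" unfolding g_def[abs_def] by measurable
  have h0: "w \<gamma> = 0 \<Longrightarrow> h \<gamma> = 0" for \<gamma> using h by (auto simp: L_w_plus_def)
  show hg: "h = (\<lambda>\<gamma>. of_real (w \<gamma>) * cnj (g \<gamma>))"
  proof
    show "h \<gamma> = of_real (w \<gamma>) * cnj (g \<gamma>)" for \<gamma>
      using h0[of \<gamma>] by (cases "w \<gamma> = 0") (auto simp: g_def w_plus_def)
  qed
  have "norm (h \<gamma>) powr q * w_plus w \<gamma> powr (q - 1) = w \<gamma> * norm (g \<gamma>) powr q" for \<gamma>
    using w_plus_powr_identity[OF q, of \<gamma> "cnj (g \<gamma>)"] fun_cong[OF hg, of \<gamma>] by simp
  then have "(\<integral>\<^sup>+\<gamma>. ennreal (w \<gamma> * norm (g \<gamma>) powr q) \<partial>\<mu>) < \<infinity>"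
    using h by (simp add: L_w_plus_def)
  then have "integrable \<mu> (\<lambda>\<gamma>. w \<gamma> * norm (g \<gamma>) powr q)"
    using w_nonneg by (intro integrableI_nonneg) (auto simp: measurable_mu)
  then show "g \<in> Lp_functions weighted q"
    by (simp add: Lp_functions_def measurable_weighted integrable_weighted_iff)
qed

lemma bounded_Lp:
  assumes p: "0 < p" and f: "f \<in> borel_measurable borel" and B: "\<And>\<gamma>. norm (f \<gamma>) \<le> B"
  shows "f \<in> Lp_functions weighted p"
proof -
  note [measurable] = f
  have "integrable weighted (\<lambda>\<gamma>. norm (f \<gamma>) powr p)"
    using p B by (intro weighted.integrable_const_bound[of _ "B powr p"])
      (auto simp: measurable_weighted intro!: powr_mono2)
  then show ?thesis using f by (simp add: Lp_functions_def measurable_weighted)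
qed

end

section \<open>Distance from a character to trigonometric polynomials\<close>

locale weighted_dual_group = integrable_weight \<mu> w
  for \<mu> :: "'a::topological_ab_group_add dual_group measure" and w
begin

lemma chi_Lp: "0 < p \<Longrightarrow> chi x \<in> Lp_functions weighted p"
  by (rule bounded_Lp[where B = 1]) auto

lemma trig_polys_Lp: "t \<in> trig_polys X \<Longrightarrow> 0 < p \<Longrightarrow> t \<in> Lp_functions weighted p"
proof (induction rule: trig_polys_induct)
  case zero
  show ?case by (rule weighted.constant_Lp)
next
  case (add t u x)
  then show ?case by (intro Lp_functions_add Lp_functions_scale chi_Lp) auto
qed

lemma inv_fourier_eq_integral_weighted:
  assumes "g \<in> Lp_functions weighted q"
  shows "inv_fourier \<mu> (\<lambda>\<gamma>. cnj (of_real (w \<gamma>) * cnj (g \<gamma>))) x = (\<integral>\<gamma>. chi x \<gamma> * g \<gamma> \<partial>weighted)"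
proof -
  have [measurable]: "g \<in> borel_measurable borel"
    using Lp_functions_measurable[OF assms] by (simp add: measurable_weighted)
  have "(\<integral>\<gamma>. chi x \<gamma> * g \<gamma> \<partial>weighted) = (\<integral>\<gamma>. w \<gamma> *\<^sub>R (chi x \<gamma> * g \<gamma>) \<partial>\<mu>)"
    by (rule integral_weighted) measurable
  then show ?thesis by (simp add: inv_fourier_def chi_def scaleR_conv_of_real ac_simps)
qed

lemma distance_integral_weighted:
  assumes "t \<in> trig_polys X"
  shows "(\<integral>\<gamma>. norm (chi s \<gamma> - t \<gamma>) powr p * w \<gamma> \<partial>\<mu>) = (\<integral>\<gamma>. norm (chi s \<gamma> - t \<gamma>) powr p \<partial>weighted)"
proof -
  have [measurable]: "t \<in> borel_measurable borel"
    using Lp_functions_measurable[OF trig_polys_Lp[OF assms zero_less_one]]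
    by (simp add: measurable_weighted)
  show ?thesis by (subst integral_weighted) (auto simp: mult.commute)
qed

lemma orthogonal_trig_polys:
  assumes p: "1 < p" and q: "q = p / (p - 1)" and g: "g \<in> Lp_functions weighted q"
    and orth: "\<And>x. x \<in> X \<Longrightarrow> (\<integral>\<gamma>. chi x \<gamma> * g \<gamma> \<partial>weighted) = 0"
    and t: "t \<in> trig_polys X"
  shows "(\<integral>\<gamma>. t \<gamma> * g \<gamma> \<partial>weighted) = 0"
proof -
  note int = Holder_integrable[OF p q _ g]
  have "integrable weighted (\<lambda>\<gamma>. t \<gamma> * g \<gamma>) \<and> (\<integral>\<gamma>. t \<gamma> * g \<gamma> \<partial>weighted) = 0"
    using t
  proof (induction rule: trig_polys_induct)
    case (add t u x)
    moreover have "integrable weighted (\<lambda>\<gamma>. chi x \<gamma> * g \<gamma>)" using p by (intro int chi_Lp) simp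
    ultimately show ?case using orth by (simp add: distrib_right mult.assoc)
  qed simp
  then show ?thesis ..
qed

lemma D_at_iff:
  assumes p: "1 < p" and q: "q = p / (p - 1)" and g: "g \<in> Lp_functions weighted q"
  shows "(\<lambda>\<gamma>. of_real (w \<gamma>) * cnj (g \<gamma>)) \<in> D_at \<mu> w q (q - 1) S s \<longleftrightarrow>
    (\<forall>x\<in>- S. (\<integral>\<gamma>. chi x \<gamma> * g \<gamma> \<partial>weighted) = 0) \<and> (\<integral>\<gamma>. chi s \<gamma> * g \<gamma> \<partial>weighted) = 1"
  using L_w_plus_I(1)[OF _ g] conjugate_exponent(1)[OF p q]
  unfolding D_at_def D_space_def mem_Collect_eq inv_fourier_eq_integral_weighted[OF g] by auto

text \<open>Hoelder's inequality for \<open>1 = \<integral> (\<chi>\<^sub>s - t) g d\<nu>\<close>, where \<open>h = w g\<^sup>*\<close>.\<close>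

lemma distance_duality_le:
  assumes p: "1 < p" and q: "q = p / (p - 1)"
    and h: "h \<in> D_at \<mu> w q (q - 1) S s" and t: "t \<in> trig_polys (- S)"
  shows "1 \<le> (\<integral>\<gamma>. norm (chi s \<gamma> - t \<gamma>) powr p \<partial>weighted) powr (1 / p)
    * (\<integral>\<gamma>. norm (h \<gamma>) powr q * w_plus w \<gamma> powr (q - 1) \<partial>\<mu>) powr (1 / q)"
proof -
  have q0: "0 < q" using conjugate_exponent(1)[OF p q] by simp
  have p0: "0 < p" using p by simp
  have "h \<in> L_w_plus \<mu> w q (q - 1)" using h by (auto simp: D_at_def D_space_def)
  then obtain g where g: "g \<in> Lp_functions weighted q" and hg: "h = (\<lambda>\<gamma>. of_real (w \<gamma>) * cnj (g \<gamma>))"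
    using L_w_plus_D[OF q0] by blast
  have orth: "\<And>x. x \<in> - S \<Longrightarrow> (\<integral>\<gamma>. chi x \<gamma> * g \<gamma> \<partial>weighted) = 0"
    and one: "(\<integral>\<gamma>. chi s \<gamma> * g \<gamma> \<partial>weighted) = 1"
    using h D_at_iff[OF p q g] unfolding hg by blast+
  have dt: "(\<lambda>\<gamma>. chi s \<gamma> - t \<gamma>) \<in> Lp_functions weighted p"
    by (intro Lp_functions_diff chi_Lp trig_polys_Lp[OF t] p0)
  have "(\<integral>\<gamma>. (chi s \<gamma> - t \<gamma>) * g \<gamma> \<partial>weighted) = 1"
    using Holder_integrable[OF p q chi_Lp[OF p0] g] Holder_integrable[OF p q trig_polys_Lp[OF t p0] g]
      orthogonal_trig_polys[OF p q g orth t] one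
    by (simp add: left_diff_distrib)
  then show ?thesis
    using Holder_inequality[OF p q dt g] unfolding hg L_w_plus_I(2)[OF q0 g] by simp
qed

text \<open>Divide the extremal functional by its value \<open>D\<close> at \<open>\<chi>\<^sub>s\<close>. The \<open>q\<close>-th power of its norm is
  then \<open>D\<^bsup>1-q\<^esup>\<close>, and \<open>(1 - q)(-1/q) = 1/p\<close>.\<close>

lemma distance_duality_attained:
  assumes p: "1 < p" and q: "q = p / (p - 1)"
    and D: "D = (INF t\<in>trig_polys (- S). \<integral>\<gamma>. norm (chi s \<gamma> - t \<gamma>) powr p \<partial>weighted)"
    and pos: "0 < D"
  obtains h where "h \<in> D_at \<mu> w q (q - 1) S s"
    and "(\<integral>\<gamma>. norm (h \<gamma>) powr q * w_plus w \<gamma> powr (q - 1) \<partial>\<mu>) powr (- 1 / q) = D powr (1 / p)"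
proof -
  note e = conjugate_exponent[OF p q]
  have q0: "0 < q" using e by simp
  have p0: "0 < p" using p by simp
  have T: "trig_polys (- S) \<subseteq> Lp_functions weighted p" using trig_polys_Lp p0 by blast
  obtain g where g: "g \<in> Lp_functions weighted q"
    and norm_g: "(\<integral>\<gamma>. norm (g \<gamma>) powr q \<partial>weighted) = D"
    and orth: "\<And>t. t \<in> trig_polys (- S) \<Longrightarrow> (\<integral>\<gamma>. t \<gamma> * g \<gamma> \<partial>weighted) = 0"
    and at_s: "(\<integral>\<gamma>. chi s \<gamma> * g \<gamma> \<partial>weighted) = of_real D"
    using weighted.Lp_distance_dual_functional[OF p q chi_Lp[OF p0] T zero_in_trig_polys
        trig_polys_add trig_polys_scale D] by blast
  define k where "k \<gamma> = of_real (1 / D) * g \<gamma>" for \<gamma>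
  have k: "k \<in> Lp_functions weighted q" unfolding k_def[abs_def] by (rule Lp_functions_scale[OF g])
  have pair_k: "(\<integral>\<gamma>. f \<gamma> * k \<gamma> \<partial>weighted) = of_real (1 / D) * (\<integral>\<gamma>. f \<gamma> * g \<gamma> \<partial>weighted)" for f
    unfolding k_def mult.left_commute[of "f _"] by simp
  have "(\<integral>\<gamma>. norm (k \<gamma>) powr q \<partial>weighted) = (1 / D) powr q * D"
    using pos by (simp add: k_def norm_mult powr_mult norm_divide norm_g powr_divide)
  also have "\<dots> = D powr (1 - q)" using pos by (simp add: powr_divide powr_diff)
  finally have norm_k: "(\<integral>\<gamma>. norm (k \<gamma>) powr q \<partial>weighted) = D powr (1 - q)" .
  have exp: "(1 - q) * (- 1 / q) = 1 / p" using e(2) q0 by (simp add: field_simps)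
  show ?thesis
  proof
    show "(\<lambda>\<gamma>. of_real (w \<gamma>) * cnj (k \<gamma>)) \<in> D_at \<mu> w q (q - 1) S s"
      unfolding D_at_iff[OF p q k] pair_k at_s
      using orth[OF chi_in_trig_polys] pos by (auto simp flip: of_real_mult)
    show "(\<integral>\<gamma>. norm (of_real (w \<gamma>) * cnj (k \<gamma>)) powr q * w_plus w \<gamma> powr (q - 1) \<partial>\<mu>) powr (- 1 / q)
        = D powr (1 / p)"
      unfolding L_w_plus_I(2)[OF q0 k] norm_k powr_powr exp ..
  qed
qed

text \<open>A nonempty \<open>D_at\<close> forces a positive distance by the weak inequality, so distance 0 falls
  under the convention for the empty set; for a positive distance the supremum is attained.\<close>

theorem distance_duality:
  assumes p: "1 < p" and q: "q = p / (p - 1)"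
  shows "(INF t\<in>trig_polys (- S).
            ereal ((\<integral>\<gamma>. norm (chi s \<gamma> - t \<gamma>) powr p * w \<gamma> \<partial>\<mu>) powr (1 / p)))
       = (if D_at \<mu> w q (q - 1) S s = {} then 0
          else SUP h\<in>D_at \<mu> w q (q - 1) S s.
            ereal ((\<integral>\<gamma>. norm (h \<gamma>) powr q * w_plus w \<gamma> powr (q - 1) \<partial>\<mu>) powr (- 1 / q)))"
proof -
  define E where "E t = (\<integral>\<gamma>. norm (chi s \<gamma> - t \<gamma>) powr p \<partial>weighted)" for t
  define N where "N h = (\<integral>\<gamma>. norm (h \<gamma>) powr q * w_plus w \<gamma> powr (q - 1) \<partial>\<mu>)" for h :: "'a dual_group \<Rightarrow> complex"
  define T where "T = trig_polys (- S)"
  define D where "D = (INF t\<in>T. E t)"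
  have E0: "0 \<le> E t" for t unfolding E_def by (auto intro!: integral_nonneg_AE)
  have T0: "T \<noteq> {}" using zero_in_trig_polys by (auto simp: T_def)
  have D0: "0 \<le> D" unfolding D_def using T0 E0 by (rule cINF_greatest)
  have bdd: "bdd_below (E ` T)" using E0 by (intro bdd_belowI[of _ 0]) auto
  have DE: "D \<le> E t" if "t \<in> T" for t unfolding D_def using bdd that by (rule cINF_lower)
  have inf: "(INF t\<in>T. ereal (E t powr (1 / p))) = ereal (D powr (1 / p))"
  proof (rule antisym)
    show "ereal (D powr (1 / p)) \<le> (INF t\<in>T. ereal (E t powr (1 / p)))"
      using p D0 DE by (intro INF_greatest) (auto intro!: powr_mono2)
    show "(INF t\<in>T. ereal (E t powr (1 / p))) \<le> ereal (D powr (1 / p))"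
    proof (rule LIMSEQ_le_const)
      show "(\<lambda>n. ereal ((D + 1 / real (Suc n)) powr (1 / p))) \<longlonglongrightarrow> ereal (D powr (1 / p))"
      proof (intro tendsto_ereal tendsto_powr')
        show "(\<lambda>n. D + 1 / real (Suc n)) \<longlonglongrightarrow> D"
          using tendsto_add[OF tendsto_const LIMSEQ_Suc[OF lim_1_over_n], of D] by simp
      qed (use p D0 in \<open>auto intro!: always_eventually\<close>)
      have "(INF t\<in>T. ereal (E t powr (1 / p))) \<le> ereal ((D + 1 / real (Suc n)) powr (1 / p))" for n
      proof -
        obtain t where "t \<in> T" "E t < D + 1 / real (Suc n)"
          using cINF_less_iff[OF T0 bdd, of "D + 1 / real (Suc n)"] by (auto simp: D_def)
        then show ?thesis
          using p E0 by (intro INF_lower2[of t]) (auto intro!: powr_mono2)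
      qed
      then show "\<exists>N. \<forall>n\<ge>N. (INF t\<in>T. ereal (E t powr (1 / p))) \<le> ereal ((D + 1 / real (Suc n)) powr (1 / p))"
        by blast
    qed
  qed
  have weak: "0 < D \<and> N h powr (- 1 / q) \<le> D powr (1 / p)" if h: "h \<in> D_at \<mu> w q (q - 1) S s" for h
  proof -
    have one_le: "1 \<le> E t powr (1 / p) * N h powr (1 / q)" if "t \<in> T" for t
      using distance_duality_le[OF p q h] that by (simp add: E_def N_def T_def)
    have "N h \<noteq> 0"
      using one_le T0 by fastforce
    then have N: "0 < N h" by (simp add: N_def less_le integral_nonneg_AE w_plus_def)
    have inv: "N h powr (- 1 / q) * N h powr (1 / q) = 1"
      using N by (simp flip: powr_add)
    have "N h powr (- 1 / q) \<le> E t powr (1 / p)" if "t \<in> T" for t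
    proof (rule mult_right_le_imp_le)
      show "N h powr (- 1 / q) * N h powr (1 / q) \<le> E t powr (1 / p) * N h powr (1 / q)"
        unfolding inv by (rule one_le[OF that])
    qed (use N in simp)
    then have "ereal (N h powr (- 1 / q)) \<le> (INF t\<in>T. ereal (E t powr (1 / p)))"
      by (intro INF_greatest) simp
    then have le: "N h powr (- 1 / q) \<le> D powr (1 / p)" unfolding inf by simp
    moreover have "0 < N h powr (- 1 / q)" using N by simp
    ultimately have "D \<noteq> 0" by auto
    with D0 le show ?thesis by simp
  qed
  have "(INF t\<in>T. ereal (E t powr (1 / p)))
      = (if D_at \<mu> w q (q - 1) S s = {} then 0
         else SUP h\<in>D_at \<mu> w q (q - 1) S s. ereal (N h powr (- 1 / q)))"
  proof (cases "D = 0")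
    case True
    then have "D_at \<mu> w q (q - 1) S s = {}" using weak by fastforce
    then show ?thesis unfolding inf using True by simp
  next
    case False
    with D0 have pos: "0 < D" by simp
    have "D = (INF t\<in>trig_polys (- S). \<integral>\<gamma>. norm (chi s \<gamma> - t \<gamma>) powr p \<partial>weighted)"
      by (simp add: D_def T_def E_def)
    then obtain h where h: "h \<in> D_at \<mu> w q (q - 1) S s" "N h powr (- 1 / q) = D powr (1 / p)"
      using distance_duality_attained[OF p q _ pos, where S = S and s = s] unfolding N_def by blast
    have "(SUP h\<in>D_at \<mu> w q (q - 1) S s. ereal (N h powr (- 1 / q))) = ereal (D powr (1 / p))"
    proof (rule antisym)
      show "(SUP h\<in>D_at \<mu> w q (q - 1) S s. ereal (N h powr (- 1 / q))) \<le> ereal (D powr (1 / p))"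
        using weak by (intro SUP_least) simp
      show "ereal (D powr (1 / p)) \<le> (SUP h\<in>D_at \<mu> w q (q - 1) S s. ereal (N h powr (- 1 / q)))"
        using h by (intro SUP_upper2[of h]) auto
    qed
    then show ?thesis unfolding inf using h by auto
  qed
  moreover have "(INF t\<in>T. ereal (E t powr (1 / p))) = (INF t\<in>trig_polys (- S).
            ereal ((\<integral>\<gamma>. norm (chi s \<gamma> - t \<gamma>) powr p * w \<gamma> \<partial>\<mu>) powr (1 / p)))"
    unfolding T_def E_def by (intro INF_cong refl) (simp add: distance_integral_weighted)
  ultimately show ?thesis unfolding N_def by simp
qed

end

theorem theorem5p3:
  fixes \<alpha> \<alpha>' \<beta> :: real
    and \<mu> :: "'a::{topological_ab_group_add, t2_space} dual_group measure"
    and w :: "'a dual_group \<Rightarrow> real"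
    and S :: "'a set" and s :: 'a
  assumes "1 < \<alpha>" and "\<alpha>' = \<alpha> / (\<alpha> - 1)" and "\<beta> = 1 / (\<alpha> - 1)"
    and "locally_compact_space (euclidean :: 'a topology)"
    and "haar_measure \<mu>"
    and "S \<noteq> {}"
    and "w \<in> borel_measurable borel" and "\<And>\<gamma>. 0 \<le> w \<gamma>" and "integrable \<mu> w"
    and "s \<in> S"
  shows "(INF t\<in>trig_polys (- S).
            ereal ((\<integral>\<gamma>. norm (chi s \<gamma> - t \<gamma>) powr \<alpha> * w \<gamma> \<partial>\<mu>) powr (1 / \<alpha>)))
       = (if D_at \<mu> w \<alpha>' \<beta> S s = {} then 0
          else SUP h\<in>D_at \<mu> w \<alpha>' \<beta> S s.
            ereal ((\<integral>\<gamma>. norm (h \<gamma>) powr \<alpha>' * w_plus w \<gamma> powr \<beta> \<partial>\<mu>) powr (- 1 / \<alpha>')))"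
proof -
  interpret weighted_dual_group \<mu> w
    using assms(5,7-9) by unfold_locales (auto simp: haar_measure_def)
  have "\<alpha>' - 1 = \<alpha> / (\<alpha> - 1) - (\<alpha> - 1) / (\<alpha> - 1)" using assms(1,2) by simp
  also have "\<dots> = \<beta>" unfolding diff_divide_distrib[symmetric] using assms(3) by simp
  finally have "\<beta> = \<alpha>' - 1" by simp
  then show ?thesis using distance_duality[OF assms(1,2)] by simp
qed

end
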